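(* There exists a countable, finitely branching, acyclic MDP $\mathcal{M}$ with integer transition rewards and initial state $s_0$, with the total reward implicit in the state, such that (1) the value of $s_0$ for the objective $\mathit{MP}_{\liminf\ge 0}=\{\rho\mid \liminf_{n\to\infty}\frac1n\sum_{j=0}^{n-1} r(e_j)\ge 0\}$ is $1$, and (2) every finite-memory randomized (FR) strategy $\sigma$ satisfies $\mathcal{P}_{\mathcal{M},s_0,\sigma}(\mathit{MP}_{\liminf\ge 0})=0$.
   Context: An MDP has a countable set of states partitioned into controlled and random states, a transition relation (every state has a successor), fixed probability distributions over successors at random states, and real rewards on transitions; runs are $s_0e_0s_1e_1\dots$ with transitions $e_j$. It is finitely branching if each state has finitely many successors and acyclic if its transition graph has no directed cycle. The total reward is implicit in the state if for every state $s$ all finite paths from $s_0$ to $s$ have the same sum of transition rewards. A strategy assigns to each finite partial run ending in a controlled state a distribution over successors, inducing a probability measure $\mathcal{P}_{\mathcal{M},s_0,\sigma}$ on runs; the value is the supremum of the objective's probability over all strategies. FR strategies are those implementable with a finite set of memory modes and (possibly randomized) memory updates and choices depending on the current mode and state. *)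

theory Defs
  imports "HOL-Probability.Probability"
begin

section \<open>Markov decision processes\<close>

text \<open>There is at most one transition between two states, so transitions are pairs of states
  and a run \<open>s\<^sub>0 e\<^sub>0 s\<^sub>1 e\<^sub>1 \<dots>\<close> is determined by its sequence of states.\<close>

record 's mdp =
  controlled_states :: "'s set"
  random_states :: "'s set"
  transitions :: "('s \<times> 's) set"
  trans_prob :: "'s \<Rightarrow> 's pmf"
  reward :: "'s \<times> 's \<Rightarrow> real"

definition states :: "'s mdp \<Rightarrow> 's set" where
  "states M = controlled_states M \<union> random_states M"

definition succs :: "'s mdp \<Rightarrow> 's \<Rightarrow> 's set" where
  "succs M s = {t. (s, t) \<in> transitions M}"

definition is_mdp :: "'s mdp \<Rightarrow> bool" where
  "is_mdp M \<longleftrightarrow>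
     countable (states M) \<and>
     controlled_states M \<inter> random_states M = {} \<and>
     transitions M \<subseteq> states M \<times> states M \<and>
     (\<forall>s\<in>states M. succs M s \<noteq> {}) \<and>
     (\<forall>s\<in>random_states M. set_pmf (trans_prob M s) \<subseteq> succs M s)"

definition finitely_branching :: "'s mdp \<Rightarrow> bool" where
  "finitely_branching M \<longleftrightarrow> (\<forall>s\<in>states M. finite (succs M s))"

definition integer_rewards :: "'s mdp \<Rightarrow> bool" where
  "integer_rewards M \<longleftrightarrow> (\<forall>e\<in>transitions M. reward M e \<in> \<int>)"

definition partial_runs :: "'s mdp \<Rightarrow> 's list set" where
  "partial_runs M =
     {\<rho>. \<rho> \<noteq> [] \<and> set \<rho> \<subseteq> states M \<and> successively (\<lambda>s t. (s, t) \<in> transitions M) \<rho>}"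

definition path_reward :: "'s mdp \<Rightarrow> 's list \<Rightarrow> real" where
  "path_reward M \<rho> = (\<Sum>i<length \<rho> - 1. reward M (\<rho> ! i, \<rho> ! Suc i))"

definition total_reward_implicit :: "'s mdp \<Rightarrow> 's \<Rightarrow> bool" where
  "total_reward_implicit M s0 \<longleftrightarrow>
     (\<forall>s\<in>states M. \<forall>\<rho>\<in>partial_runs M. \<forall>\<rho>'\<in>partial_runs M.
        hd \<rho> = s0 \<and> last \<rho> = s \<and> hd \<rho>' = s0 \<and> last \<rho>' = s \<longrightarrow>
        path_reward M \<rho> = path_reward M \<rho>')"


section \<open>Strategies and the induced measure on runs\<close>

text \<open>Values of a strategy on lists that are not partial runs ending in a controlled state
  are irrelevant and left unconstrained.\<close>

type_synonym 's strategy = "'s list \<Rightarrow> 's pmf"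

definition strategies :: "'s mdp \<Rightarrow> 's strategy set" where
  "strategies M =
     {\<sigma>. \<forall>\<rho>\<in>partial_runs M. last \<rho> \<in> controlled_states M \<longrightarrow> set_pmf (\<sigma> \<rho>) \<subseteq> succs M (last \<rho>)}"

definition next_state :: "'s mdp \<Rightarrow> 's strategy \<Rightarrow> 's list \<Rightarrow> 's pmf" where
  "next_state M \<sigma> \<rho> = (if last \<rho> \<in> controlled_states M then \<sigma> \<rho> else trans_prob M (last \<rho>))"

text \<open>The conditional law of the \<open>i\<close>-th state given the states \<open>\<omega> 0, \<dots>, \<omega> (i - 1)\<close>.\<close>

definition step_kernel :: "'s mdp \<Rightarrow> 's \<Rightarrow> 's strategy \<Rightarrow> nat \<Rightarrow> (nat \<Rightarrow> 's) \<Rightarrow> 's measure" where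
  "step_kernel M s0 \<sigma> i \<omega> =
     measure_pmf (if i = 0 then return_pmf s0 else next_state M \<sigma> (map \<omega> [0..<i]))"

text \<open>The Ionescu-Tulcea extension of these kernels. The state type is countable so that all
  sets of states, and all functions of a finite history, are measurable.\<close>

definition run_measure :: "'s::countable mdp \<Rightarrow> 's \<Rightarrow> 's strategy \<Rightarrow> (nat \<Rightarrow> 's) measure" where
  "run_measure M s0 \<sigma> =
     projective_family.lim UNIV
       (Ionescu_Tulcea.CI (step_kernel M s0 \<sigma>) (\<lambda>_. count_space UNIV)) (\<lambda>_. count_space UNIV)"

definition runs :: "'s mdp \<Rightarrow> (nat \<Rightarrow> 's) set" where
  "runs M = {\<omega>. \<forall>i. \<omega> i \<in> states M \<and> (\<omega> i, \<omega> (Suc i)) \<in> transitions M}"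

definition MP_liminf_ge_0 :: "'s mdp \<Rightarrow> (nat \<Rightarrow> 's) set" where
  "MP_liminf_ge_0 M =
     {\<omega> \<in> runs M. liminf (\<lambda>n. ereal (1 / real n * (\<Sum>j<n. reward M (\<omega> j, \<omega> (Suc j))))) \<ge> 0}"

definition mdp_value :: "'s::countable mdp \<Rightarrow> 's \<Rightarrow> (nat \<Rightarrow> 's) set \<Rightarrow> real" where
  "mdp_value M s0 Obj = (SUP \<sigma>\<in>strategies M. measure (run_measure M s0 \<sigma>) Obj)"


section \<open>Finite-memory randomized strategies\<close>

text \<open>An update function \<open>\<tau>\<close> with modes in \<open>Q\<close> jointly randomizes the next mode and the next
  state. At random states the state component must follow the MDP.\<close>

definition memory_update :: "'s mdp \<Rightarrow> 'm set \<Rightarrow> ('m \<Rightarrow> 's \<Rightarrow> ('m \<times> 's) pmf) \<Rightarrow> bool" where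
  "memory_update M Q \<tau> \<longleftrightarrow>
     (\<forall>m\<in>Q. \<forall>s\<in>controlled_states M. set_pmf (\<tau> m s) \<subseteq> Q \<times> succs M s) \<and>
     (\<forall>m\<in>Q. \<forall>s\<in>random_states M. set_pmf (\<tau> m s) \<subseteq> Q \<times> UNIV \<and> map_pmf snd (\<tau> m s) = trans_prob M s)"

text \<open>The law of the first \<open>n + 1\<close> states of the Markov chain on modes and states that
  starts in \<open>(m0, s)\<close> and has transition probabilities \<open>\<tau>\<close>.\<close>

fun memory_chain :: "('m \<Rightarrow> 's \<Rightarrow> ('m \<times> 's) pmf) \<Rightarrow> 'm \<Rightarrow> 's \<Rightarrow> nat \<Rightarrow> ('m \<times> 's) list pmf" where
  "memory_chain \<tau> m0 s 0 = return_pmf [(m0, s)]"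
| "memory_chain \<tau> m0 s (Suc n) =
     bind_pmf (memory_chain \<tau> m0 s n)
       (\<lambda>h. map_pmf (\<lambda>q. h @ [q]) (\<tau> (fst (last h)) (snd (last h))))"

abbreviation history_chain ::
  "('m \<Rightarrow> 's \<Rightarrow> ('m \<times> 's) pmf) \<Rightarrow> 'm \<Rightarrow> 's list \<Rightarrow> ('m \<times> 's) list pmf" where
  "history_chain \<tau> m0 \<rho> \<equiv> memory_chain \<tau> m0 (hd \<rho>) (length \<rho> - 1)"

definition compatible :: "'s list \<Rightarrow> ('m \<times> 's) list set" where
  "compatible \<rho> = {h. map snd h = \<rho>}"

definition mode_dist :: "('m \<Rightarrow> 's \<Rightarrow> ('m \<times> 's) pmf) \<Rightarrow> 'm \<Rightarrow> 's list \<Rightarrow> 'm pmf" where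
  "mode_dist \<tau> m0 \<rho> =
     map_pmf (\<lambda>h. fst (last h)) (cond_pmf (history_chain \<tau> m0 \<rho>) (compatible \<rho>))"

definition induced_strategy :: "('m \<Rightarrow> 's \<Rightarrow> ('m \<times> 's) pmf) \<Rightarrow> 'm \<Rightarrow> 's strategy" where
  "induced_strategy \<tau> m0 \<rho> = bind_pmf (mode_dist \<tau> m0 \<rho>) (\<lambda>m. map_pmf snd (\<tau> m (last \<rho>)))"

text \<open>The conditional distribution of the mode only exists for histories of positive probability.
  The strategy is arbitrary on the other ones, which does not affect the measure on runs.\<close>

definition implements ::
  "'s mdp \<Rightarrow> 'm set \<Rightarrow> ('m \<Rightarrow> 's \<Rightarrow> ('m \<times> 's) pmf) \<Rightarrow> 'm \<Rightarrow> 's strategy \<Rightarrow> bool" where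
  "implements M Q \<tau> m0 \<sigma> \<longleftrightarrow>
     m0 \<in> Q \<and> memory_update M Q \<tau> \<and>
     (\<forall>\<rho>\<in>partial_runs M. last \<rho> \<in> controlled_states M \<and>
        set_pmf (history_chain \<tau> m0 \<rho>) \<inter> compatible \<rho> \<noteq> {} \<longrightarrow>
        \<sigma> \<rho> = induced_strategy \<tau> m0 \<rho>)"

text \<open>Every finite set of modes can be taken to be a set of natural numbers.\<close>

definition FR_strategies :: "'s mdp \<Rightarrow> 's strategy set" where
  "FR_strategies M =
     {\<sigma> \<in> strategies M. \<exists>(Q :: nat set) \<tau> m0. finite Q \<and> implements M Q \<tau> m0 \<sigma>}"


section \<open>Basic facts about the measure on runs\<close>

lemma measurable_history:
  "(\<lambda>\<omega>. map \<omega> [0..<i]) \<in>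
     measurable (PiM {0..<i} (\<lambda>_. count_space (UNIV :: 's::countable set))) (count_space UNIV)"
proof -
  let ?N = "PiM {0..<i} (\<lambda>_. count_space (UNIV :: 's set))"
  have "(\<lambda>\<omega>. map \<omega> js) \<in> measurable ?N (count_space UNIV)" if "set js \<subseteq> {0..<i}" for js
    using that
  proof (induction js)
    case (Cons j js)
    then have [measurable]: "(\<lambda>\<omega>. map \<omega> js) \<in> measurable ?N (count_space UNIV)"
      and j: "(\<lambda>\<omega>. \<omega> j) \<in> measurable ?N (count_space UNIV)"
      using measurable_component_singleton[of j "{0..<i}" "\<lambda>_. count_space (UNIV :: 's set)"] by auto
    note [measurable] = j
    have "(\<lambda>\<omega>. \<omega> j # map \<omega> js) \<in> measurable ?N (count_space UNIV)"
      by (rule measurable_compose_countable[OF _ j]) simp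
    then show ?case by simp
  qed simp
  then show ?thesis by simp
qed

lemma Ionescu_Tulcea_kernel:
  "Ionescu_Tulcea (step_kernel (M :: 's::countable mdp) s0 \<sigma>) (\<lambda>_. count_space UNIV)"
proof (rule Ionescu_Tulcea.intro)
  fix i :: nat
  let ?f = "\<lambda>\<rho>. measure_pmf (if i = 0 then return_pmf s0 else next_state M \<sigma> \<rho>)"
  have "?f \<in> measurable (count_space UNIV) (subprob_algebra (count_space UNIV))"
    by (simp add: space_subprob_algebra measure_pmf.subprob_space_axioms)
  from measurable_compose[OF measurable_history this]
  show "step_kernel M s0 \<sigma> i \<in> measurable (PiM {0..<i} (\<lambda>_. count_space UNIV))
      (subprob_algebra (count_space UNIV))"
    by (simp add: step_kernel_def[abs_def])
next
  fix i :: nat and x :: "nat \<Rightarrow> 's"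
  show "prob_space (step_kernel M s0 \<sigma> i x)"
    by (simp add: step_kernel_def measure_pmf.prob_space_axioms)
qed

lemma prob_space_run_measure: "prob_space (run_measure M s0 \<sigma>)"
proof -
  interpret Ionescu_Tulcea "step_kernel M s0 \<sigma>" "\<lambda>_. count_space UNIV"
    by (rule Ionescu_Tulcea_kernel)
  have e: "PF.emb UNIV {} {\<lambda>_. undefined} = space PF.lim"
    by (auto simp: prod_emb_def space_PiM)
  have "emeasure PF.lim (PF.emb UNIV {} {\<lambda>_. undefined}) = emeasure (CI {}) {\<lambda>_. undefined}"
    by (rule lim) (auto simp: PiM_empty)
  also have "\<dots> = emeasure (CI {}) (space (CI {}))"
    by (simp add: CI_def space_PiM)
  also have "\<dots> = 1"
    using PF.prob_space_P[of "{}"] by (simp add: prob_space.emeasure_space_1)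
  finally show ?thesis
    unfolding run_measure_def e by (rule prob_spaceI)
qed

lemma sets_run_measure [measurable_cong]:
  "sets (run_measure M s0 \<sigma>) = sets (PiM UNIV (\<lambda>_. count_space UNIV))"
proof -
  interpret Ionescu_Tulcea "step_kernel M s0 \<sigma>" "\<lambda>_. count_space UNIV"
    by (rule Ionescu_Tulcea_kernel)
  show ?thesis by (simp add: run_measure_def)
qed

lemma space_run_measure [simp]: "space (run_measure M s0 \<sigma>) = UNIV"
  using sets_eq_imp_space_eq[OF sets_run_measure] by (simp add: space_PiM)

lemma sets_MP_liminf_ge_0 [measurable]:
  "MP_liminf_ge_0 (M :: 's::countable mdp) \<in> sets (PiM UNIV (\<lambda>_. count_space UNIV))"
proof -
  let ?N = "PiM UNIV (\<lambda>_::nat. count_space (UNIV :: 's set))"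
  have c [measurable]: "(\<lambda>\<omega>. \<omega> i) \<in> measurable ?N (count_space UNIV)" for i
    by (rule measurable_component_singleton) simp
  have p: "(\<lambda>\<omega>. (\<omega> i, \<omega> (Suc i))) \<in> measurable ?N (count_space UNIV)" for i
    by (rule measurable_compose_countable[OF _ c[of i]]) measurable
  have r [measurable]: "(\<lambda>\<omega>. reward M (\<omega> i, \<omega> (Suc i))) \<in> borel_measurable ?N" for i
    by (rule measurable_compose[OF p]) simp
  have t [measurable]: "Measurable.pred ?N (\<lambda>\<omega>. (\<omega> i, \<omega> (Suc i)) \<in> transitions M)" for i
    by (rule measurable_compose[OF p]) simp
  have s [measurable]: "Measurable.pred ?N (\<lambda>\<omega>. \<omega> i \<in> states M)" for i
    by (rule measurable_compose[OF c]) simp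
  have "{\<omega> \<in> space ?N. (\<forall>i. \<omega> i \<in> states M \<and> (\<omega> i, \<omega> (Suc i)) \<in> transitions M) \<and>
      0 \<le> liminf (\<lambda>n. ereal (1 / real n * (\<Sum>j<n. reward M (\<omega> j, \<omega> (Suc j)))))} \<in> sets ?N"
    by measurable
  then show ?thesis
    by (simp add: MP_liminf_ge_0_def runs_def space_PiM)
qed

end

theory Submission
  imports Defs
begin

text \<open>The MDP is a sequence of gadgets. In a gadget a random branch \<open>i\<close> determines a delay
  before a common controlled state, where a number \<open>j\<close> is chosen; the total reward then
  dips to a depth increasing in \<open>j\<close> and recovers. Delays and depths grow so fast that the dip
  brings the mean payoff below \<open>-1\<close> if \<open>j > i\<close> and is negligible if \<open>j \<le> i\<close>; but a small
  \<open>j\<close> carries a larger risk of a further dip that is harmful in any case. A strategy that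
  remembers the branch chooses \<open>j = i\<close>, and by Borel--Cantelli it almost surely suffers only
  finitely many harmful dips. With finitely many modes and more branches than modes, some mode
  must serve two branches, so that harmful dips occur with probabilities that are not
  summable, whatever happened before.\<close>

section \<open>Probabilities of histories\<close>

text \<open>Since the total reward is a function of the state, the branch can leave its mark on
  \<open>Choice n\<close> only in the elapsed time, that is, in the denominator of the mean payoff;
  hence branches differ by delays.

  Branch probabilities and risks run along opposite geometric scales. With r =
  \<open>ratio d\<close>, matching j = i costs at most r^(d+1) on each branch, while sharing a mode
  between two branches costs at least r^d / (d+1), up to the number of modes. The first cost must be
  summable over the gadgets and the second not, even after division by an unknown number of modes.
  So each width is repeated in a block, and because one MDP has to defeat all finite memories, the
  widths tend to infinity.

  Losses in successive gadgets are not independent, as the mode on entering a gadget carries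
  information about earlier ones; a converse Borel-Cantelli argument for independent events is out
  of reach. Instead the loss is bounded after every single history. Such bounds multiply, and the
  product of the factors 1 - \<open>gap n\<close> / K vanishes.\<close>

definition cyl :: "'s list \<Rightarrow> (nat \<Rightarrow> 's) set" where
  "cyl \<rho> = {\<omega>. map \<omega> [0..<length \<rho>] = \<rho>}"

lemma cyl_snoc: "cyl (\<rho> @ [t]) = cyl \<rho> \<inter> {\<omega>. \<omega> (length \<rho>) = t}"
  by (auto simp: cyl_def)

definition path_prob :: "'s::countable mdp \<Rightarrow> 's \<Rightarrow> 's strategy \<Rightarrow> 's list \<Rightarrow> real" where
  "path_prob M s0 \<sigma> \<rho> = measure (run_measure M s0 \<sigma>) (cyl \<rho>)"

lemma path_prob_nonneg [simp]: "0 \<le> path_prob M s0 \<sigma> \<rho>"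
  by (simp add: path_prob_def)

lemma measurable_run_history [measurable]:
  "(\<lambda>\<omega>. map \<omega> [0..<i]) \<in> measurable (run_measure (M :: 's::countable mdp) s0 \<sigma>) (count_space UNIV)"
proof -
  have "(\<lambda>\<omega>. map \<omega> js) \<in> measurable (run_measure M s0 \<sigma>) (count_space UNIV)" for js :: "nat list"
  proof (induction js)
    case (Cons j js)
    note [measurable] = Cons
    have j: "(\<lambda>\<omega>. \<omega> j) \<in> measurable (run_measure M s0 \<sigma>) (count_space UNIV)"
      unfolding measurable_cong_sets[OF sets_run_measure refl]
      by (rule measurable_component_singleton) simp
    have "(\<lambda>\<omega>. \<omega> j # map \<omega> js) \<in> measurable (run_measure M s0 \<sigma>) (count_space UNIV)"
      by (rule measurable_compose_countable[OF _ j]) measurable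
    then show ?case by simp
  qed simp
  then show ?thesis .
qed

lemma sets_run_history [measurable]:
  "{\<omega>. map \<omega> [0..<i] \<in> L} \<in> sets (run_measure (M :: 's::countable mdp) s0 \<sigma>)"
  using measurable_sets[OF measurable_run_history[of i M s0 \<sigma>], of L] by (simp add: vimage_def)

lemma measurable_run_state [measurable]:
  "(\<lambda>\<omega>. \<omega> i) \<in> measurable (run_measure (M :: 's::countable mdp) s0 \<sigma>) (count_space UNIV)"
  unfolding measurable_cong_sets[OF sets_run_measure refl]
  by (rule measurable_component_singleton) simp

lemma sets_visited [measurable]:
  "{\<omega>. \<exists>t. \<omega> t = s} \<in> sets (run_measure (M :: 's::countable mdp) s0 \<sigma>)"
proof -
  have "{\<omega>. \<exists>t. \<omega> t = s} = (\<Union>t. (\<lambda>\<omega>. \<omega> t) -` {s} \<inter> space (run_measure M s0 \<sigma>))"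
    by auto
  also have "\<dots> \<in> sets (run_measure M s0 \<sigma>)"
    by (intro sets.countable_UN image_subsetI measurable_sets[OF measurable_run_state]) auto
  finally show ?thesis .
qed

lemma sets_cyl [measurable]: "cyl \<rho> \<in> sets (run_measure (M :: 's::countable mdp) s0 \<sigma>)"
  using sets_run_history[of "length \<rho>" "{\<rho>}"] by (simp add: cyl_def)

text \<open>The chain rule, and the one place below where the Ionescu-Tulcea construction is opened:
  a cylinder is embedded from the coordinates below its length, where the measure is
  \<open>C 0 n\<close>, and \<open>C 0 (Suc n)\<close> is \<open>C 0 n\<close> bound to the kernel
  \<open>eP n\<close>.\<close>

lemma path_prob_snoc:
  fixes M :: "'s::countable mdp"
  shows "path_prob M s0 \<sigma> (\<rho> @ [t]) =
    path_prob M s0 \<sigma> \<rho> * pmf (if \<rho> = [] then return_pmf s0 else next_state M \<sigma> \<rho>) t"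
proof -
  interpret IT: Ionescu_Tulcea "step_kernel M s0 \<sigma>" "\<lambda>_. count_space (UNIV :: 's set)"
    by (rule Ionescu_Tulcea_kernel)
  let ?N = "\<lambda>n. PiM {0..<n} (\<lambda>_. count_space (UNIV :: 's set))"
  let ?C = "\<lambda>n. IT.C 0 n (\<lambda>_. undefined)"
  let ?E = "\<lambda>\<rho>. {x \<in> space (?N (length \<rho>)). map x [0..<length \<rho>] = \<rho>}"
  have E: "?E \<rho> \<in> sets (?N (length \<rho>))" for \<rho>
    using measurable_sets[OF measurable_history[of "length \<rho>"], of "{\<rho>}"]
    by (auto simp: vimage_def Int_def conj_commute)
  have lim: "emeasure (run_measure M s0 \<sigma>) (cyl \<rho>) = emeasure (?C (length \<rho>)) (?E \<rho>)" for \<rho>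
  proof -
    have "cyl \<rho> = IT.PF.emb UNIV {0..<length \<rho>} (?E \<rho>)"
    proof -
      have *: "map (restrict x {0..<length \<rho>}) [0..<length \<rho>] = map x [0..<length \<rho>]" for x :: "nat \<Rightarrow> 's"
        by simp
      then show ?thesis
        by (simp add: cyl_def prod_emb_def space_PiM vimage_def * del: restrict_apply)
    qed
    then have "emeasure (run_measure M s0 \<sigma>) (cyl \<rho>) = emeasure (IT.CI {0..<length \<rho>}) (?E \<rho>)"
      unfolding run_measure_def by (simp add: IT.lim E)
    also have "\<dots> = emeasure (?C (length \<rho>)) (IT.PF.emb {0..<length \<rho>} {0..<length \<rho>} (?E \<rho>))"
      by (rule IT.emeasure_CI) (auto simp: E)
    also have "IT.PF.emb {0..<length \<rho>} {0..<length \<rho>} (?E \<rho>) = ?E \<rho>"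
      by (rule prod_emb_id) (use sets.sets_into_space[OF E[of \<rho>]] in \<open>simp add: space_PiM\<close>)
    finally show ?thesis .
  qed
  define n where "n = length \<rho>"
  let ?K = "if \<rho> = [] then return_pmf s0 else next_state M \<sigma> \<rho>"
  have u: "(\<lambda>_. undefined) \<in> space (?N 0)" by (simp add: space_PiM PiE_def extensional_def)
  have "emeasure (?C (Suc n)) (?E (\<rho> @ [t])) =
      (\<integral>\<^sup>+x. emeasure (IT.eP n x) (?E (\<rho> @ [t])) \<partial>?C n)"
  proof -
    have ne: "space (?C n) \<noteq> {}"
      unfolding IT.space_C[OF u] by (simp add: space_PiM PiE_eq_empty_iff)
    have m: "IT.eP (0 + n) \<in> measurable (?C n) (subprob_algebra (?N (Suc n)))"
      unfolding measurable_cong_sets[OF IT.sets_C[OF u, of n] refl] using IT.measurable_eP[of n] by simp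
    show ?thesis
      using emeasure_bind[OF ne m, of "?E (\<rho> @ [t])"] E[of "\<rho> @ [t]"] by (simp add: n_def)
  qed
  also have "\<dots> = (\<integral>\<^sup>+x. ennreal (pmf ?K t) * indicator (?E \<rho>) x \<partial>?C n)"
  proof (rule nn_integral_cong)
    fix x assume "x \<in> space (?C n)"
    then have x: "x \<in> space (?N n)" using IT.space_C[OF u, of n] by simp
    have *: "(\<lambda>a. x(n := a)) -` ?E (\<rho> @ [t]) = (if map x [0..<n] = \<rho> then {t} else {})"
      using x by (auto simp: n_def space_PiM PiE_def extensional_def)
    have "emeasure (IT.eP n x) (?E (\<rho> @ [t])) =
        emeasure (step_kernel M s0 \<sigma> n x) ((\<lambda>a. x(n := a)) -` ?E (\<rho> @ [t]))"
      by (subst IT.emeasure_eP[OF x]) (use E[of "\<rho> @ [t]"] in \<open>auto simp: n_def\<close>)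
    also have "\<dots> = ennreal (pmf ?K t) * indicator (?E \<rho>) x"
      unfolding * using x
      by (auto simp: step_kernel_def n_def emeasure_pmf_single)
    finally show "emeasure (IT.eP n x) (?E (\<rho> @ [t])) = ennreal (pmf ?K t) * indicator (?E \<rho>) x" .
  qed
  also have "\<dots> = ennreal (pmf ?K t) * emeasure (?C n) (?E \<rho>)"
    by (rule nn_integral_cmult_indicator) (use E[of \<rho>] IT.sets_C[OF u, of n] in \<open>simp add: n_def\<close>)
  finally have "emeasure (run_measure M s0 \<sigma>) (cyl (\<rho> @ [t])) =
      ennreal (pmf ?K t) * emeasure (run_measure M s0 \<sigma>) (cyl \<rho>)"
    using lim[of \<rho>] lim[of "\<rho> @ [t]"] by (simp add: n_def)
  then show ?thesis
    by (simp add: path_prob_def measure_def enn2real_mult mult.commute)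
qed

lemma path_prob_Nil: "path_prob M s0 \<sigma> [] = 1"
proof -
  interpret prob_space "run_measure M s0 \<sigma>" by (rule prob_space_run_measure)
  show ?thesis using prob_space by (simp add: path_prob_def cyl_def)
qed

lemma path_prob_singleton: "path_prob M s0 \<sigma> [t] = (if t = s0 then 1 else 0)"
  using path_prob_snoc[of M s0 \<sigma> "[]" t] by (simp add: path_prob_Nil pmf_return)

text \<open>There are countably many lists, so almost every run avoids all cylinders of probability
  0; each factor in the chain rule along such a run is then nonzero.\<close>

lemma AE_run_follows:
  fixes M :: "'s::countable mdp"
  shows "AE \<omega> in run_measure M s0 \<sigma>. \<omega> 0 = s0 \<and>
    (\<forall>t. \<omega> (Suc t) \<in> set_pmf (next_state M \<sigma> (map \<omega> [0..<Suc t])))"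
proof -
  interpret prob_space "run_measure M s0 \<sigma>" by (rule prob_space_run_measure)
  have "AE \<omega> in run_measure M s0 \<sigma>. \<omega> \<notin> cyl \<rho>" if "path_prob M s0 \<sigma> \<rho> = 0" for \<rho>
    using that by (intro AE_not_in null_setsI) (auto simp: path_prob_def emeasure_eq_measure)
  then have "AE \<omega> in run_measure M s0 \<sigma>. \<forall>\<rho>. path_prob M s0 \<sigma> \<rho> = 0 \<longrightarrow> \<omega> \<notin> cyl \<rho>"
    by (subst AE_all_countable) auto
  then show ?thesis
  proof eventually_elim
    case (elim \<omega>)
    have pos: "path_prob M s0 \<sigma> (map \<omega> [0..<n]) \<noteq> 0" for n
      using elim[rule_format, of "map \<omega> [0..<n]"] by (auto simp: cyl_def)
    have "\<omega> 0 = s0"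
      using pos[of 1] by (auto simp: path_prob_singleton split: if_splits)
    moreover have "\<omega> (Suc t) \<in> set_pmf (next_state M \<sigma> (map \<omega> [0..<Suc t]))" for t
      using pos[of "Suc (Suc t)"] path_prob_snoc[of M s0 \<sigma> "map \<omega> [0..<Suc t]" "\<omega> (Suc t)"]
      by (auto simp: set_pmf_iff)
    ultimately show ?case by simp
  qed
qed

text \<open>The histories that end in their first visit to \<open>s\<close> have disjoint cylinders,
  and each is extended by \<open>s'\<close> with the same factor, whatever the strategy does
  elsewhere. This bounds harmful events without describing the law of the past.\<close>

lemma prob_first_visit_step:
  fixes M :: "'s::countable mdp"
  assumes s: "s \<notin> controlled_states M"
  shows "measure (run_measure M s0 \<sigma>)
    {\<omega>. \<exists>t. \<omega> t = s \<and> (\<forall>u<t. \<omega> u \<noteq> s) \<and> \<omega> (Suc t) = s'} \<le>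
    pmf (trans_prob M s) s' * measure (run_measure M s0 \<sigma>) {\<omega>. \<exists>t. \<omega> t = s}"
proof -
  interpret prob_space "run_measure M s0 \<sigma>" by (rule prob_space_run_measure)
  define F where "F t = {\<omega>. \<omega> t = s \<and> (\<forall>u<t. \<omega> u \<noteq> s)}" for t :: nat
  define G where "G t = {\<omega>. \<omega> t = s \<and> (\<forall>u<t. \<omega> u \<noteq> s) \<and> \<omega> (Suc t) = s'}" for t :: nat
  define L where "L t = {\<rho>. length \<rho> = Suc t \<and> \<rho> ! t = s \<and> (\<forall>u<t. \<rho> ! u \<noteq> s)}" for t :: nat
  let ?p = "pmf (trans_prob M s) s'"
  have F: "F t = (\<Union>\<rho>\<in>L t. cyl \<rho>)" for t
  proof -
    have "\<omega> \<in> F t \<longleftrightarrow> map \<omega> [0..<Suc t] \<in> L t" for \<omega>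
      by (simp add: F_def L_def del: upt_Suc)
    moreover have "\<omega> \<in> (\<Union>\<rho>\<in>L t. cyl \<rho>) \<longleftrightarrow> map \<omega> [0..<Suc t] \<in> L t" for \<omega>
    proof
      assume "\<omega> \<in> (\<Union>\<rho>\<in>L t. cyl \<rho>)"
      then obtain \<rho> where "\<rho> \<in> L t" "map \<omega> [0..<length \<rho>] = \<rho>" "length \<rho> = Suc t"
        unfolding cyl_def L_def by blast
      then show "map \<omega> [0..<Suc t] \<in> L t" by metis
    next
      assume "map \<omega> [0..<Suc t] \<in> L t"
      then show "\<omega> \<in> (\<Union>\<rho>\<in>L t. cyl \<rho>)"
        by (rule UN_I) (simp add: cyl_def del: upt_Suc)
    qed
    ultimately show ?thesis by blast
  qed
  have G: "G t = (\<Union>\<rho>\<in>L t. cyl (\<rho> @ [s']))" for t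
  proof -
    have "G t = F t \<inter> {\<omega>. \<omega> (Suc t) = s'}" unfolding F_def G_def by blast
    also have "\<dots> = (\<Union>\<rho>\<in>L t. cyl \<rho> \<inter> {\<omega>. \<omega> (Suc t) = s'})"
      unfolding F by blast
    also have "\<dots> = (\<Union>\<rho>\<in>L t. cyl (\<rho> @ [s']))"
      by (rule SUP_cong) (simp_all add: cyl_snoc L_def)
    finally show ?thesis .
  qed
  have disj: "disjoint_family_on cyl (L t)" "disjoint_family_on (\<lambda>\<rho>. cyl (\<rho> @ [s'])) (L t)" for t
  proof -
    have "\<rho> = \<rho>'" if "\<rho> \<in> L t" "\<rho>' \<in> L t" "\<omega> \<in> cyl \<rho>" "\<omega> \<in> cyl \<rho>'" for \<rho> \<rho>' \<omega>
      using that unfolding cyl_def L_def by (metis (mono_tags, lifting) mem_Collect_eq)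
    moreover have "cyl (\<rho> @ [s']) \<subseteq> cyl \<rho>" for \<rho>
      by (simp add: cyl_snoc)
    ultimately show "disjoint_family_on cyl (L t)" "disjoint_family_on (\<lambda>\<rho>. cyl (\<rho> @ [s'])) (L t)"
      unfolding disjoint_family_on_def by blast+
  qed
  have emb: "emeasure (run_measure M s0 \<sigma>) (G t) = ennreal ?p * emeasure (run_measure M s0 \<sigma>) (F t)" for t
  proof -
    have "emeasure (run_measure M s0 \<sigma>) (G t) =
        (\<integral>\<^sup>+\<rho>. emeasure (run_measure M s0 \<sigma>) (cyl (\<rho> @ [s'])) \<partial>count_space (L t))"
      unfolding G by (rule emeasure_UN_countable) (auto simp: disj)
    also have "\<dots> = (\<integral>\<^sup>+\<rho>. ennreal ?p * emeasure (run_measure M s0 \<sigma>) (cyl \<rho>) \<partial>count_space (L t))"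
    proof (rule nn_integral_cong)
      fix \<rho> assume "\<rho> \<in> space (count_space (L t))"
      then have "length \<rho> = Suc t" "\<rho> ! t = s" by (auto simp: L_def)
      moreover from this have "\<rho> \<noteq> []" by auto
      ultimately have "\<rho> \<noteq> []" "last \<rho> = s" by (auto simp: last_conv_nth)
      then show "emeasure (run_measure M s0 \<sigma>) (cyl (\<rho> @ [s'])) =
          ennreal ?p * emeasure (run_measure M s0 \<sigma>) (cyl \<rho>)"
        using path_prob_snoc[of M s0 \<sigma> \<rho> s'] s
        by (simp add: path_prob_def emeasure_eq_measure next_state_def ennreal_mult' mult.commute)
    qed
    also have "\<dots> = ennreal ?p * (\<integral>\<^sup>+\<rho>. emeasure (run_measure M s0 \<sigma>) (cyl \<rho>) \<partial>count_space (L t))"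
      by (rule nn_integral_cmult) simp
    also have "(\<integral>\<^sup>+\<rho>. emeasure (run_measure M s0 \<sigma>) (cyl \<rho>) \<partial>count_space (L t)) =
        emeasure (run_measure M s0 \<sigma>) (F t)"
      unfolding F by (rule emeasure_UN_countable[symmetric]) (auto simp: disj)
    finally show ?thesis .
  qed
  have sF: "F t \<in> sets (run_measure M s0 \<sigma>)" for t unfolding F by auto
  have sG: "G t \<in> sets (run_measure M s0 \<sigma>)" for t unfolding G by auto
  have dF: "disjoint_family F" "disjoint_family G"
  proof -
    have "m = n" if "\<omega> \<in> F m" "\<omega> \<in> F n" for m n \<omega>
      using that unfolding F_def by (metis (mono_tags, lifting) linorder_neqE_nat mem_Collect_eq)
    moreover have "G n \<subseteq> F n" for n by (auto simp: F_def G_def)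
    ultimately show "disjoint_family F" "disjoint_family G"
      unfolding disjoint_family_on_def by blast+
  qed
  have "emeasure (run_measure M s0 \<sigma>) (\<Union>t. G t) = (\<Sum>t. emeasure (run_measure M s0 \<sigma>) (G t))"
    by (rule suminf_emeasure[symmetric]) (use sG dF in auto)
  also have "\<dots> = ennreal ?p * (\<Sum>t. emeasure (run_measure M s0 \<sigma>) (F t))"
    by (simp add: emb)
  also have "(\<Sum>t. emeasure (run_measure M s0 \<sigma>) (F t)) = emeasure (run_measure M s0 \<sigma>) (\<Union>t. F t)"
    by (rule suminf_emeasure) (use sF dF in auto)
  also have "(\<Union>t. F t) \<subseteq> {\<omega>. \<exists>t. \<omega> t = s}" by (auto simp: F_def)
  then have "ennreal ?p * emeasure (run_measure M s0 \<sigma>) (\<Union>t. F t) \<le>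
      ennreal ?p * emeasure (run_measure M s0 \<sigma>) {\<omega>. \<exists>t. \<omega> t = s}"
    by (intro mult_left_mono emeasure_mono sets_visited) auto
  finally have "measure (run_measure M s0 \<sigma>) (\<Union>t. G t) \<le>
      ?p * measure (run_measure M s0 \<sigma>) {\<omega>. \<exists>t. \<omega> t = s}"
    by (simp add: emeasure_eq_measure ennreal_mult'[symmetric])
  moreover have "(\<Union>t. G t) = {\<omega>. \<exists>t. \<omega> t = s \<and> (\<forall>u<t. \<omega> u \<noteq> s) \<and> \<omega> (Suc t) = s'}"
    by (auto simp: G_def)
  ultimately show ?thesis by simp
qed

section \<open>Finite-memory strategies as mixtures over modes\<close>

text \<open>Forgets all modes but the current one. What is left is still a Markov chain
  (\<open>mode_chain_Suc\<close>), and its point masses are joint weights of a history and a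
  mode.\<close>

definition mode_chain :: "('m \<Rightarrow> 's \<Rightarrow> ('m \<times> 's) pmf) \<Rightarrow> 'm \<Rightarrow> 's \<Rightarrow> nat \<Rightarrow> ('s list \<times> 'm) pmf" where
  "mode_chain \<tau> m0 s n = map_pmf (\<lambda>h. (map snd h, fst (last h))) (memory_chain \<tau> m0 s n)"

lemma memory_chain_length:
  "h \<in> set_pmf (memory_chain \<tau> m0 s n) \<Longrightarrow> length h = Suc n"
  by (induction n arbitrary: h) auto

lemma mode_chain_Suc:
  "mode_chain \<tau> m0 s (Suc n) = bind_pmf (mode_chain \<tau> m0 s n)
     (\<lambda>(\<rho>, m). map_pmf (\<lambda>(m', t). (\<rho> @ [t], m')) (\<tau> m (last \<rho>)))"
proof -
  have "snd (last h) = last (map snd h)" if "h \<in> set_pmf (memory_chain \<tau> m0 s n)" for h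
    using memory_chain_length[OF that] by (subst last_map) auto
  then show ?thesis
    unfolding mode_chain_def memory_chain.simps map_bind_pmf bind_map_pmf
    by (intro bind_pmf_cong refl) (simp add: pmf.map_comp o_def case_prod_unfold)
qed

text \<open>\<open>memory_update\<close> constrains \<open>\<tau>\<close> only at states of the MDP,
  hence the restriction on \<open>\<rho>\<close>.\<close>

lemma mode_chain_modes:
  assumes "memory_update M Q \<tau>" "m0 \<in> Q"
    "(\<rho>, m) \<in> set_pmf (mode_chain \<tau> m0 s n)" "set \<rho> \<subseteq> states M"
  shows "m \<in> Q \<and> length \<rho> = Suc n"
  using assms(3,4)
proof (induction n arbitrary: \<rho> m)
  case 0
  then show ?case using assms(2) by (simp add: mode_chain_def)
next
  case (Suc n)
  then obtain \<rho>' m' t where *: "(\<rho>', m') \<in> set_pmf (mode_chain \<tau> m0 s n)" "\<rho> = \<rho>' @ [t]"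
    "(m, t) \<in> set_pmf (\<tau> m' (last \<rho>'))"
    unfolding mode_chain_Suc by auto
  then have m': "m' \<in> Q" "length \<rho>' = Suc n" using Suc by auto
  then have "last \<rho>' \<in> states M" using Suc.prems(2) *(2) by (cases \<rho>' rule: rev_cases) auto
  then show ?case
    using assms(1) m' *(2,3) by (fastforce simp: memory_update_def states_def)
qed

lemma pmf_map_snd_sum:
  assumes "finite Q" "set_pmf p \<subseteq> Q \<times> UNIV"
  shows "pmf (map_pmf snd p) t = (\<Sum>m\<in>Q. pmf p (m, t))"
proof -
  have "pmf (map_pmf snd p) t = measure p (snd -` {t})" by (rule pmf_map)
  also have "\<dots> = measure p (Q \<times> {t})"
    by (rule measure_eq_AE) (use assms(2) in \<open>auto simp: AE_measure_pmf_iff\<close>)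
  also have "\<dots> = (\<Sum>q\<in>Q \<times> {t}. pmf p q)"
    using assms(1) by (intro measure_measure_pmf_finite) auto
  also have "\<dots> = (\<Sum>m\<in>Q. pmf p (m, t))"
    by (simp add: sum.cartesian_product')
  finally show ?thesis .
qed

text \<open>\<open>w \<rho> m\<close> is the unnormalized probability of having history
  \<open>\<rho>\<close> and mode \<open>m\<close>, so that the conditional law in
  \<open>mode_dist\<close> disappears. What finite memory means is that \<open>c m\<close> does not
  see the history.\<close>

lemma FR_mixture:
  fixes M :: "'s::countable mdp"
  assumes "is_mdp M" "\<sigma> \<in> FR_strategies M"
  obtains Q :: "nat set" and w :: "'s list \<Rightarrow> nat \<Rightarrow> real" and c :: "nat \<Rightarrow> 's \<Rightarrow> 's pmf"
  where "finite Q" "Q \<noteq> {}" "\<And>\<rho> m. 0 \<le> w \<rho> m"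
    "\<And>m s. m \<in> Q \<Longrightarrow> s \<in> controlled_states M \<Longrightarrow> set_pmf (c m s) \<subseteq> succs M s"
    "\<And>\<rho>. \<rho> \<in> partial_runs M \<Longrightarrow> hd \<rho> = s0 \<Longrightarrow> path_prob M s0 \<sigma> \<rho> = (\<Sum>m\<in>Q. w \<rho> m)"
    "\<And>\<rho> t. \<rho> \<in> partial_runs M \<Longrightarrow> hd \<rho> = s0 \<Longrightarrow> last \<rho> \<in> controlled_states M \<Longrightarrow>
      path_prob M s0 \<sigma> (\<rho> @ [t]) = (\<Sum>m\<in>Q. w \<rho> m * pmf (c m (last \<rho>)) t)"
proof -
  from assms obtain Q :: "nat set" and \<tau> m0
    where Q: "finite Q" and impl: "implements M Q \<tau> m0 \<sigma>" and \<sigma>: "\<sigma> \<in> strategies M"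
    by (auto simp: FR_strategies_def)
  have m0: "m0 \<in> Q" and upd: "memory_update M Q \<tau>"
    using impl by (auto simp: implements_def)
  define J where "J = mode_chain \<tau> m0 s0"
  define w where "w \<rho> m = pmf (J (length \<rho> - 1)) (\<rho>, m)" for \<rho> m
  define c where "c m s = map_pmf snd (\<tau> m s)" for m s
  have supp: "set_pmf (\<tau> m s) \<subseteq> Q \<times> UNIV" if "m \<in> Q" "s \<in> states M" for m s
    using upd that by (fastforce simp: memory_update_def states_def)
  have w_snoc: "w (\<rho> @ [t]) m' = (\<Sum>m\<in>Q. w \<rho> m * pmf (\<tau> m (last \<rho>)) (m', t))"
    if \<rho>: "\<rho> \<in> partial_runs M" for \<rho> t m'
  proof -
    define n where "n = length \<rho> - 1"
    have len: "length \<rho> = Suc n" and st: "set \<rho> \<subseteq> states M"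
      using \<rho> by (auto simp: n_def partial_runs_def)
    let ?f = "\<lambda>(\<rho>', m). pmf (map_pmf (\<lambda>(m', t). (\<rho>' @ [t], m')) (\<tau> m (last \<rho>'))) (\<rho> @ [t], m')"
    have f: "?f (\<rho>', m) = (if \<rho>' = \<rho> then pmf (\<tau> m (last \<rho>)) (m', t) else 0)" for \<rho>' m
    proof (cases "\<rho>' = \<rho>")
      case True
      have "pmf (map_pmf (\<lambda>(m', t). (\<rho> @ [t], m')) (\<tau> m (last \<rho>))) ((\<lambda>(m', t). (\<rho> @ [t], m')) (m', t)) =
          pmf (\<tau> m (last \<rho>)) (m', t)"
        by (rule pmf_map_inj') (auto simp: inj_def)
      then show ?thesis using True by simp
    next
      case False
      then show ?thesis by (auto intro!: pmf_map_outside)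
    qed
    have "w (\<rho> @ [t]) m' = pmf (J (Suc n)) (\<rho> @ [t], m')"
      by (simp add: w_def len)
    also have "\<dots> = (\<integral>x. ?f x \<partial>J n)"
      unfolding J_def mode_chain_Suc pmf_bind by (simp add: split_beta)
    also have "\<dots> = (\<Sum>x\<in>{\<rho>} \<times> Q. ?f x * pmf (J n) x)"
    proof (rule integral_measure_pmf_real)
      fix x assume x: "x \<in> set_pmf (J n)" "?f x \<noteq> 0"
      obtain \<rho>' m where [simp]: "x = (\<rho>', m)" by (cases x)
      have "\<rho>' = \<rho>" using x(2) f[of \<rho>' m] by (auto split: if_splits)
      then show "x \<in> {\<rho>} \<times> Q"
        using x(1) mode_chain_modes[OF upd m0, of \<rho> m s0 n] st by (simp add: J_def)
    qed (use Q in auto)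
    also have "\<dots> = (\<Sum>m\<in>Q. ?f (\<rho>, m) * pmf (J n) (\<rho>, m))"
      by (subst sum.cartesian_product') simp
    finally show ?thesis
      unfolding f by (simp add: w_def len mult.commute)
  qed
  have step: "path_prob M s0 \<sigma> (\<rho> @ [t]) = (\<Sum>m\<in>Q. w \<rho> m * pmf (c m (last \<rho>)) t)"
    if \<rho>: "\<rho> \<in> partial_runs M" "hd \<rho> = s0" and eq: "path_prob M s0 \<sigma> \<rho> = (\<Sum>m\<in>Q. w \<rho> m)" for \<rho> t
  proof -
    let ?P = "path_prob M s0 \<sigma> \<rho>"
    have ne: "\<rho> \<noteq> []" and st: "set \<rho> \<subseteq> states M" using \<rho> by (auto simp: partial_runs_def)
    have snoc: "path_prob M s0 \<sigma> (\<rho> @ [t]) = ?P * pmf (next_state M \<sigma> \<rho>) t"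
      using ne by (simp add: path_prob_snoc)
    show ?thesis
    proof (cases "last \<rho> \<in> controlled_states M")
      case False
      then have "last \<rho> \<in> random_states M"
        using ne st by (auto simp: states_def dest!: last_in_set)
      then have "c m (last \<rho>) = trans_prob M (last \<rho>)" if "m \<in> Q" for m
        using upd that by (auto simp: memory_update_def c_def)
      then show ?thesis
        unfolding snoc eq using False by (simp add: next_state_def sum_distrib_right)
    next
      case True
      show ?thesis
      \<comment> \<open>On a null history \<open>implements\<close> leaves the strategy free, but
        then all weights vanish and both sides are 0.\<close>
      proof (cases "?P = 0")
        case True
        then have "w \<rho> m = 0" if "m \<in> Q" for m
          using that eq Q sum_nonneg_eq_0_iff[of Q "w \<rho>"] by (auto simp: w_def)
        then show ?thesis using snoc True by simp
      next
        case False
        define n where "n = length \<rho> - 1"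
        have w_n: "w \<rho> m = pmf (J n) (\<rho>, m)" for m by (simp add: w_def n_def)
        let ?C = "history_chain \<tau> m0 \<rho>"
        let ?h = "\<lambda>h. (map snd h, fst (last h))"
        let ?S = "{\<rho>} \<times> (UNIV :: nat set)"
        have J: "J n = map_pmf ?h ?C" using \<rho> by (simp add: J_def mode_chain_def n_def)
        have comp: "?h -` ?S = compatible \<rho>"
          by (auto simp: compatible_def)
        obtain m where "m \<in> Q" "w \<rho> m \<noteq> 0" using False eq by (metis sum.neutral)
        then have inJ: "(\<rho>, m) \<in> set_pmf (J n)" by (simp add: w_def n_def set_pmf_iff)
        then have ne': "set_pmf (J n) \<inter> ?S \<noteq> {}" by auto
        then have ne'': "set_pmf ?C \<inter> compatible \<rho> \<noteq> {}"
          unfolding J comp[symmetric] by auto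
        \<comment> \<open>The conditioning moves from lists of modes and states to the pairs of
          \<open>J n\<close>, whose point masses are the weights \<open>w\<close>.\<close>
        have mode: "mode_dist \<tau> m0 \<rho> = map_pmf snd (cond_pmf (J n) ?S)"
        proof -
          have "cond_pmf (J n) ?S = map_pmf ?h (cond_pmf ?C (?h -` ?S))"
            unfolding J by (rule cond_map_pmf) (use ne'' comp in auto)
          then show ?thesis
            by (simp add: mode_dist_def comp pmf.map_comp o_def)
        qed
        have supJ: "x \<in> {\<rho>} \<times> Q" if "x \<in> set_pmf (J n)" "x \<in> ?S" for x
          using that mode_chain_modes[OF upd m0, of \<rho> _ s0 n] st by (auto simp: J_def)
        have mS: "measure (J n) ?S = ?P"
        proof -
          have "measure (J n) ?S = measure (J n) ({\<rho>} \<times> Q)"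
            by (rule measure_eq_AE) (use supJ in \<open>auto simp: AE_measure_pmf_iff\<close>)
          also have "\<dots> = (\<Sum>x\<in>{\<rho>} \<times> Q. pmf (J n) x)"
            using Q by (intro measure_measure_pmf_finite) auto
          also have "\<dots> = ?P"
            unfolding eq by (subst sum.cartesian_product') (simp add: w_def n_def)
          finally show ?thesis .
        qed
        have "next_state M \<sigma> \<rho> = induced_strategy \<tau> m0 \<rho>"
          using impl True \<rho> ne'' by (auto simp: implements_def next_state_def)
        also have "\<dots> = bind_pmf (cond_pmf (J n) ?S) (\<lambda>x. c (snd x) (last \<rho>))"
          by (simp add: induced_strategy_def mode c_def bind_map_pmf)
        finally have "pmf (next_state M \<sigma> \<rho>) t =
            (\<integral>x. pmf (c (snd x) (last \<rho>)) t \<partial>cond_pmf (J n) ?S)"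
          by (simp add: pmf_bind)
        also have "\<dots> = (\<Sum>x\<in>{\<rho>} \<times> Q. pmf (c (snd x) (last \<rho>)) t * pmf (cond_pmf (J n) ?S) x)"
        proof (rule integral_measure_pmf_real)
          fix x assume "x \<in> set_pmf (cond_pmf (J n) ?S)"
          then show "x \<in> {\<rho>} \<times> Q" using supJ set_cond_pmf[OF ne'] by blast
        qed (use Q in auto)
        also have "\<dots> = (\<Sum>m\<in>Q. pmf (c m (last \<rho>)) t * (w \<rho> m / ?P))"
          by (subst sum.cartesian_product') (simp add: pmf_cond[OF ne'] mS w_n)
        finally show ?thesis
          unfolding snoc using False by (simp add: sum_distrib_left mult.commute)
      qed
    qed
  qed
  have eq: "path_prob M s0 \<sigma> \<rho> = (\<Sum>m\<in>Q. w \<rho> m)" if "\<rho> \<in> partial_runs M" "hd \<rho> = s0" for \<rho>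
    using that
  proof (induction \<rho> rule: rev_induct)
    case Nil
    then show ?case by (simp add: partial_runs_def)
  next
    case (snoc t \<rho>)
    show ?case
    proof (cases "\<rho> = []")
      case True
      then have [simp]: "t = s0" using snoc.prems by simp
      have "w [s0] m = (if m = m0 then 1 else 0)" for m
        by (simp add: w_def J_def mode_chain_def)
      then show ?thesis using True Q m0 by (simp add: path_prob_singleton)
    next
      case False
      then have \<rho>: "\<rho> \<in> partial_runs M" "hd \<rho> = s0"
        using snoc.prems by (auto simp: partial_runs_def successively_append_iff)
      have last: "last \<rho> \<in> states M" using False \<rho>(1) by (auto simp: partial_runs_def)
      have "(\<Sum>m'\<in>Q. w (\<rho> @ [t]) m') = (\<Sum>m'\<in>Q. \<Sum>m\<in>Q. w \<rho> m * pmf (\<tau> m (last \<rho>)) (m', t))"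
        by (simp add: w_snoc[OF \<rho>(1)])
      also have "\<dots> = (\<Sum>m\<in>Q. \<Sum>m'\<in>Q. w \<rho> m * pmf (\<tau> m (last \<rho>)) (m', t))"
        by (rule sum.swap)
      also have "\<dots> = (\<Sum>m\<in>Q. w \<rho> m * pmf (c m (last \<rho>)) t)"
        by (intro sum.cong refl)
          (simp add: c_def pmf_map_snd_sum[OF Q supp[OF _ last]] sum_distrib_left)
      also have "\<dots> = path_prob M s0 \<sigma> (\<rho> @ [t])"
        using step[OF \<rho> snoc.IH[OF \<rho>]] by simp
      finally show ?thesis by simp
    qed
  qed
  show thesis
  proof (rule that[of Q w c])
    show "set_pmf (c m s) \<subseteq> succs M s" if "m \<in> Q" "s \<in> controlled_states M" for m s
      using upd that by (fastforce simp: memory_update_def c_def)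
    show "path_prob M s0 \<sigma> (\<rho> @ [t]) = (\<Sum>m\<in>Q. w \<rho> m * pmf (c m (last \<rho>)) t)"
      if "\<rho> \<in> partial_runs M" "hd \<rho> = s0" for \<rho> t
      using step[OF that eq[OF that]] .
  qed (use Q m0 eq in \<open>auto simp: w_def\<close>)
qed

section \<open>Quantitative parameters of the gadgets\<close>

text \<open>Two branches \<open>i < i'\<close> reach the choice with the same most likely mode \<open>m\<close>. Mode \<open>m\<close>
  either often chooses some \<open>j > i\<close>, which is lost for branch \<open>i\<close>, or often some \<open>j \<le> i\<close>,
  which risks \<open>\<epsilon> j\<close> on branch \<open>i'\<close>.\<close>

lemma pigeonhole_loss:
  fixes \<mu> x :: "nat \<Rightarrow> 'm \<Rightarrow> real" and \<delta> \<epsilon> :: "nat \<Rightarrow> real"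
  assumes Q: "finite Q" "Q \<noteq> {}" "card Q \<le> d"
    and \<mu>: "\<And>i m. 0 \<le> \<mu> i m" "\<And>i. i \<le> d \<Longrightarrow> (\<Sum>m\<in>Q. \<mu> i m) = \<delta> i * p"
    and p: "0 \<le> p" and \<delta>: "(\<Sum>i\<le>d. \<delta> i) = 1"
    and x: "\<And>j m. 0 \<le> x j m" "\<And>m. m \<in> Q \<Longrightarrow> (\<Sum>j\<le>d. x j m) = 1"
    and \<epsilon>: "\<And>j. 0 \<le> \<epsilon> j" "\<And>j. \<epsilon> j \<le> 1"
    and b: "\<And>i. i \<le> d \<Longrightarrow> b \<le> \<delta> i" "\<And>i j. j < i \<Longrightarrow> i \<le> d \<Longrightarrow> b \<le> \<delta> i * \<epsilon> j"
  shows "(\<Sum>i\<le>d. \<Sum>j\<le>i. (1 - \<epsilon> j) * (\<Sum>m\<in>Q. \<mu> i m * x j m)) \<le> (1 - b / card Q) * p"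
proof -
  \<comment> \<open>The probability that mode \<open>m\<close> loses on branch \<open>i\<close>: it
    chooses some j > i, or it chooses j \<le> i and the risk \<open>\<epsilon> j\<close>
    strikes.\<close>
  define L where "L i m = 1 - (\<Sum>j\<le>i. (1 - \<epsilon> j) * x j m)" for i m
  have cQ: "0 < card Q" using Q by (simp add: card_gt_0_iff)
  have x_le: "(\<Sum>j\<le>i. x j m) + (\<Sum>j\<in>{Suc i..d}. x j m) = 1" if "m \<in> Q" "i \<le> d" for i m
  proof -
    have "{..d} = {..i} \<union> {Suc i..d}" using that by auto
    then show ?thesis using x(2)[OF that(1)] by (subst sum.union_disjoint[symmetric]) auto
  qed
  have x_tail: "0 \<le> (\<Sum>j\<in>{Suc i..d}. x j m)" for i m by (intro sum_nonneg x)
  have L_eq: "L i m = (1 - (\<Sum>j\<le>i. x j m)) + (\<Sum>j\<le>i. \<epsilon> j * x j m)" for i m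
    by (simp add: L_def left_diff_distrib sum_subtractf)
  have eps_nonneg: "0 \<le> (\<Sum>j\<le>i. \<epsilon> j * x j m)" for i m
    by (intro sum_nonneg mult_nonneg_nonneg \<epsilon> x)
  have L_nonneg: "0 \<le> L i m" if "m \<in> Q" "i \<le> d" for i m
    using x_le[OF that] x_tail[of m i] eps_nonneg[of m i] by (simp add: L_eq)
  have lhs: "(\<Sum>i\<le>d. \<Sum>j\<le>i. (1 - \<epsilon> j) * (\<Sum>m\<in>Q. \<mu> i m * x j m)) =
      p - (\<Sum>i\<le>d. \<Sum>m\<in>Q. \<mu> i m * L i m)"
  proof -
    have "(\<Sum>j\<le>i. (1 - \<epsilon> j) * (\<Sum>m\<in>Q. \<mu> i m * x j m)) =
        (\<Sum>m\<in>Q. \<mu> i m) - (\<Sum>m\<in>Q. \<mu> i m * L i m)" for i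
    proof -
      have "(\<Sum>j\<le>i. (1 - \<epsilon> j) * (\<Sum>m\<in>Q. \<mu> i m * x j m)) =
          (\<Sum>j\<le>i. \<Sum>m\<in>Q. \<mu> i m * ((1 - \<epsilon> j) * x j m))"
        by (simp add: sum_distrib_left mult_ac)
      also have "\<dots> = (\<Sum>m\<in>Q. \<mu> i m * (\<Sum>j\<le>i. (1 - \<epsilon> j) * x j m))"
        by (subst sum.swap) (simp add: sum_distrib_left)
      finally show ?thesis
        by (simp add: L_def right_diff_distrib sum_subtractf)
    qed
    moreover have "(\<Sum>i\<le>d. \<Sum>m\<in>Q. \<mu> i m) = p"
      using \<delta> by (simp add: \<mu>(2) flip: sum_distrib_right)
    ultimately show ?thesis by (simp add: sum_subtractf)
  qed
  \<comment> \<open>Averaging: some mode carries at least a 1 / \<open>card Q\<close> share of the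
    weight of branch \<open>i\<close>.\<close>
  have "\<exists>m\<in>Q. \<delta> i * p / card Q \<le> \<mu> i m" if "i \<le> d" for i
  proof (rule ccontr)
    assume "\<not> ?thesis"
    then have "(\<Sum>m\<in>Q. \<mu> i m) < (\<Sum>m\<in>Q. \<delta> i * p / card Q)"
      using Q by (intro sum_strict_mono) auto
    then show False using \<mu>(2)[OF that] cQ by simp
  qed
  then obtain f where f: "\<And>i. i \<le> d \<Longrightarrow> f i \<in> Q \<and> \<delta> i * p / card Q \<le> \<mu> i (f i)"
    by metis
  have "\<not> inj_on f {..d}"
  proof
    assume "inj_on f {..d}"
    then have "card {..d} \<le> card Q"
      using f Q by (intro card_inj_on_le[of f]) auto
    then show False using Q by simp
  qed
  then obtain i i' where i: "i < i'" "i' \<le> d" "f i = f i'"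
    unfolding inj_on_def by (metis atMost_iff linorder_neqE_nat)
  define m where "m = f i"
  \<comment> \<open>The chance that the shared mode chooses some j \<le> i. Branch \<open>i\<close>
    loses in proportion to 1 - y and branch \<open>i'\<close> in proportion to y, so the sum of the
    two bounds no longer depends on y.\<close>
  define y where "y = (\<Sum>j\<le>i. x j m)"
  have m: "m \<in> Q" "\<delta> i * p / card Q \<le> \<mu> i m" "\<delta> i' * p / card Q \<le> \<mu> i' m"
    using f[of i] f[of i'] i by (auto simp: m_def)
  have y: "0 \<le> y" "y \<le> 1"
    using x_le[of m i] x_tail[of m i] i m x by (auto simp: y_def intro!: sum_nonneg)
  have "p / card Q * b * (1 - y) \<le> p / card Q * \<delta> i * (1 - y)"
    using b(1)[of i] i p y by (intro mult_right_mono mult_left_mono) auto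
  also have "\<dots> \<le> \<mu> i m * (1 - y)"
    using m(2) y by (intro mult_right_mono) (auto simp: mult.commute)
  also have "\<dots> \<le> \<mu> i m * L i m"
    using eps_nonneg[of m i] by (intro mult_left_mono \<mu>) (simp add: L_eq y_def)
  finally have 1: "p / card Q * b * (1 - y) \<le> \<mu> i m * L i m" .
  have "p / card Q * b * y = p / card Q * (\<Sum>j\<le>i. b * x j m)"
    by (simp add: y_def sum_distrib_left mult.assoc)
  also have "\<dots> \<le> p / card Q * (\<Sum>j\<le>i. (\<delta> i' * \<epsilon> j) * x j m)"
    using b(2)[of _ i'] i p x by (intro mult_left_mono sum_mono mult_right_mono) auto
  also have "\<dots> = (\<delta> i' * p / card Q) * (\<Sum>j\<le>i. \<epsilon> j * x j m)"
    by (simp add: sum_distrib_left mult_ac)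
  also have "\<dots> \<le> \<mu> i' m * (\<Sum>j\<le>i. \<epsilon> j * x j m)"
    using m(3) eps_nonneg by (intro mult_right_mono)
  also have "\<dots> \<le> \<mu> i' m * (\<Sum>j\<le>i'. \<epsilon> j * x j m)"
    using i \<epsilon> x by (intro mult_left_mono \<mu> sum_mono2) auto
  also have "\<dots> \<le> \<mu> i' m * L i' m"
    using x_le[OF m(1) i(2)] x_tail[of m i'] by (intro mult_left_mono \<mu>) (simp add: L_eq)
  finally have 2: "p / card Q * b * y \<le> \<mu> i' m * L i' m" .
  have "p / card Q * b = p / card Q * b * (1 - y) + p / card Q * b * y"
    unfolding distrib_left[symmetric] by simp
  also have "\<dots> \<le> \<mu> i m * L i m + \<mu> i' m * L i' m"
    using 1 2 by simp
  also have "\<dots> = (\<Sum>k\<in>{i, i'}. \<mu> k m * L k m)" using i by simp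
  also have "\<dots> \<le> (\<Sum>k\<le>d. \<mu> k m * L k m)"
    using i m by (intro sum_mono2) (auto intro!: mult_nonneg_nonneg \<mu> L_nonneg)
  also have "\<dots> \<le> (\<Sum>k\<le>d. \<Sum>m\<in>Q. \<mu> k m * L k m)"
    using m(1) Q by (intro sum_mono member_le_sum) (auto intro!: mult_nonneg_nonneg \<mu> L_nonneg)
  finally show ?thesis unfolding lhs by (simp add: algebra_simps)
qed

text \<open>With \<open>ratio d\<close> the memoryful loss \<open>(d + 1) * ratio d ^ (d + 1)\<close> of a gadget of width
  \<open>d\<close> is so much smaller than the finite-memory loss \<open>ratio d ^ d / (d + 1)\<close> that repeating
  the gadget until the latter adds up to 1 leaves a geometrically small total of the former.\<close>

definition ratio :: "nat \<Rightarrow> real" where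
  "ratio d = (1 / 8) ^ Suc d"

text \<open>The sequence 0, 1, 2, ... with each k repeated \<open>R k\<close> times:
  \<open>width n\<close> is the first block that ends after \<open>n\<close>. Sums are evaluated at
  block ends only, which is enough for series of nonnegative terms.\<close>

lemma block_sequence:
  fixes R :: "nat \<Rightarrow> nat"
  assumes R: "\<And>k. 0 < R k"
  shows "\<exists>width :: nat \<Rightarrow> nat. (\<forall>K n. (\<Sum>k<K. R k) \<le> n \<longrightarrow> K \<le> width n) \<and>
    (\<forall>(f :: nat \<Rightarrow> real) K. (\<Sum>n<(\<Sum>k<K. R k). f (width n)) = (\<Sum>k<K. R k * f k))"
proof -
  define start where "start K = (\<Sum>k<K. R k)" for K
  define width where "width n = (LEAST k. n < start (Suc k))" for n
  have start_ge: "K \<le> start K" for K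
  proof (induction K)
    case (Suc K)
    then show ?case using R[of K] by (simp add: start_def)
  qed simp
  have start_mono: "start K \<le> start K'" if "K \<le> K'" for K K'
    unfolding start_def using that by (intro sum_mono2) auto
  have width: "n < start (Suc (width n))" for n
    unfolding width_def by (rule LeastI[of _ n]) (use start_ge[of "Suc n"] in simp)
  have width_ge: "K \<le> width n" if "start K \<le> n" for K n
    using width[of n] that start_mono[of "Suc (width n)" K] by linarith
  have width_eq: "width n = K" if "start K \<le> n" "n < start (Suc K)" for K n
    using width_ge[OF that(1)] Least_le[of "\<lambda>k. n < start (Suc k)" K] that(2) by (simp add: width_def)
  have "(\<Sum>n<start K. f (width n)) = (\<Sum>k<K. R k * f k)" for f :: "nat \<Rightarrow> real" and K
  proof (induction K)
    case 0
    then show ?case by (simp add: start_def)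
  next
    case (Suc K)
    have "(\<Sum>n<start (Suc K). f (width n)) = (\<Sum>n<start K. f (width n)) + (\<Sum>n=start K..<start (Suc K). f (width n))"
      unfolding lessThan_atLeast0 by (rule sum.atLeastLessThan_concat[symmetric]) (auto simp: start_mono)
    also have "(\<Sum>n=start K..<start (Suc K). f (width n)) = (\<Sum>n=start K..<start (Suc K). f K)"
      by (intro sum.cong refl) (auto simp: width_eq)
    also have "\<dots> = R K * f K" by (simp add: start_def)
    finally show ?case using Suc by simp
  qed
  with width_ge show ?thesis
    unfolding start_def by blast
qed

lemma gadget_sizes:
  obtains width :: "nat \<Rightarrow> nat" where
    "\<And>K. eventually (\<lambda>n. K \<le> width n) sequentially"
    "summable (\<lambda>n. Suc (width n) * ratio (width n) ^ Suc (width n))"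
    "\<not> summable (\<lambda>n. ratio (width n) ^ width n / Suc (width n))"
proof -
  \<comment> \<open>The reciprocal of \<open>ratio k ^ k / Suc k\<close>: each block adds exactly 1
    to the divergent series, and (k+1)^2 / 8^(k+1) to the convergent one.\<close>
  define R :: "nat \<Rightarrow> nat" where "R k = Suc k * 8 ^ (Suc k * k)" for k
  have R: "0 < R k" for k by (simp add: R_def)
  obtain width where width: "(\<forall>K n. (\<Sum>k<K. R k) \<le> n \<longrightarrow> K \<le> width n) \<and>
      (\<forall>(f :: nat \<Rightarrow> real) K. (\<Sum>n<(\<Sum>k<K. R k). f (width n)) = (\<Sum>k<K. R k * f k))"
    using block_sequence[of R, OF R] by (elim exE)
  note width_ge = width[THEN conjunct1, rule_format]
  note width_sum = width[THEN conjunct2, rule_format]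
  have R_ratio: "R k * ratio k ^ k = Suc k" for k
  proof -
    have "8 ^ (Suc k * k) * ratio k ^ k = 1"
      unfolding ratio_def power_mult[symmetric] power_mult_distrib[symmetric] by simp
    then show ?thesis by (simp add: R_def del: power_Suc mult_Suc)
  qed
  show thesis
  proof (rule that[of width])
    show "eventually (\<lambda>n. K \<le> width n) sequentially" for K
      using width_ge by (auto simp: eventually_sequentially)
    show "summable (\<lambda>n. Suc (width n) * ratio (width n) ^ Suc (width n))"
    proof (rule summableI_nonneg_bounded)
      show "0 \<le> Suc (width n) * ratio (width n) ^ Suc (width n)" for n by (simp add: ratio_def)
      fix N
      \<comment> \<open>Every block is nonempty, so N blocks cover the first N terms and the partial
        sum may be extended to a block end.\<close>
      have ge: "N \<le> (\<Sum>k<N. R k)"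
        using sum_mono[of "{..<N}" "\<lambda>_. 1" R] R by (simp add: Suc_le_eq)
      have "(\<Sum>n<N. Suc (width n) * ratio (width n) ^ Suc (width n)) \<le>
          (\<Sum>n<(\<Sum>k<N. R k). Suc (width n) * ratio (width n) ^ Suc (width n))"
        using ge by (intro sum_mono2) (auto simp: ratio_def)
      also have "\<dots> = (\<Sum>k<N. R k * (Suc k * ratio k ^ Suc k))"
        by (rule width_sum)
      also have "\<dots> \<le> (\<Sum>k<N. (1 / 2) ^ Suc k)"
      proof (rule sum_mono)
        fix k
        have "R k * (Suc k * ratio k ^ Suc k) = (R k * ratio k ^ k) * (Suc k * ratio k)"
          by simp
        also have "\<dots> = real (Suc k) * real (Suc k) * ratio k"
          unfolding R_ratio by simp
        \<comment> \<open>Here the base 8 of \<open>ratio\<close> is used: the two factors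
          \<open>Suc k\<close> consume 2 * 2 and leave the ratio 1/2.\<close>
        also have "\<dots> \<le> 2 ^ Suc k * 2 ^ Suc k * ratio k"
        proof (intro mult_right_mono mult_mono)
          have "real (Suc k) \<le> real (2 ^ Suc k)"
            by (subst of_nat_le_iff) (rule less_imp_le[OF less_exp])
          then show "real (Suc k) \<le> 2 ^ Suc k" by simp
          then show "real (Suc k) \<le> 2 ^ Suc k" .
        qed (auto simp: ratio_def)
        also have "\<dots> = (2 * 2 * (1 / 8)) ^ Suc k"
          unfolding ratio_def power_mult_distrib ..
        also have "\<dots> = (1 / 2) ^ Suc k" by simp
        finally show "R k * (Suc k * ratio k ^ Suc k) \<le> (1 / 2) ^ Suc k" .
      qed
      also have "\<dots> \<le> 1"
      proof -
        have "(\<lambda>k. (1 / 2 :: real) ^ Suc k) sums 1" by (rule power_half_series)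
        then show ?thesis using sum_le_suminf[of "\<lambda>k. (1 / 2 :: real) ^ Suc k" "{..<N}"]
          by (auto simp: sums_iff)
      qed
      finally show "(\<Sum>n<N. Suc (width n) * ratio (width n) ^ Suc (width n)) \<le> 1" .
    qed
    show "\<not> summable (\<lambda>n. ratio (width n) ^ width n / Suc (width n))"
    proof
      let ?b = "\<lambda>n. ratio (width n) ^ width n / Suc (width n)"
      assume s: "summable ?b"
      have "real K \<le> suminf ?b" for K
      proof -
        have "real K = (\<Sum>k<K. R k * (ratio k ^ k / Suc k))"
          using R_ratio by simp
        also have "\<dots> = (\<Sum>n<(\<Sum>k<K. R k). ?b n)" by (rule width_sum[symmetric])
        also have "\<dots> \<le> suminf ?b"
          using s by (intro sum_le_suminf) (auto simp: ratio_def)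
        finally show ?thesis .
      qed
      then show False using reals_Archimedean2[of "suminf ?b"] by (meson not_less)
    qed
  qed
qed

section \<open>The MDP\<close>

datatype node = Start nat | Delay nat nat nat | Choice nat | Dip nat nat

instance node :: countable by countable_datatype

text \<open>\<open>Start n\<close> branches randomly to \<open>Delay n i _\<close> with \<open>i \<le> width n\<close>, whose last argument counts
  down to the common controlled state \<open>Choice n\<close>. Its successors \<open>Dip n j\<close> have total reward
  \<open>- depth width n j\<close>; \<open>Dip n (Suc (width n))\<close> is the dip that no delay can hide.\<close>

fun depth :: "(nat \<Rightarrow> nat) \<Rightarrow> nat \<Rightarrow> nat \<Rightarrow> nat" where
  "depth width 0 0 = 0"
| "depth width (Suc n) 0 = depth width n (Suc (width n))"
| "depth width n (Suc j) = depth width n 0 + Suc n * depth width n j + 5"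

text \<open>The branch probabilities grow with \<open>i\<close> as fast as the probability of falling from
  \<open>Dip n j\<close> into the deepest dip decreases with \<open>j\<close>: their product for \<open>i = j\<close> is about
  \<open>ratio d ^ Suc d\<close>, but at least about \<open>ratio d ^ d\<close> for \<open>j < i\<close>.\<close>

lemma branch_pmf_exists:
  "\<exists>p. set_pmf p \<subseteq> {..d} \<and>
    (\<forall>i\<le>d. ratio d ^ (d - i) / Suc d \<le> pmf p i \<and> pmf p i \<le> ratio d ^ (d - i))"
proof -
  let ?w = "\<lambda>i. ratio d ^ (d - i)"
  have r: "0 < ratio d" "ratio d \<le> 1"
    unfolding ratio_def by (simp, intro power_le_one) auto
  \<comment> \<open>The normalization lies between 1, its term for i = d, and the number
    \<open>Suc d\<close> of its terms; this yields the two bounds.\<close>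
  define W where "W = (\<Sum>i\<le>d. ?w i)"
  have "?w d \<le> W"
    unfolding W_def using r by (intro member_le_sum) auto
  then have W1: "1 \<le> W" by simp
  have "W \<le> (\<Sum>i\<le>d. 1)"
    unfolding W_def using r by (intro sum_mono power_le_one) auto
  then have W2: "W \<le> Suc d" by simp
  define f where "f i = (if i \<le> d then ?w i / W else 0)" for i
  have f0: "0 \<le> f i" for i using r W1 by (simp add: f_def)
  have "(\<integral>\<^sup>+i. ennreal (f i) \<partial>count_space UNIV) = (\<Sum>i\<le>d. ennreal (f i))"
    by (rule nn_integral_count_space') (auto simp: f_def)
  also have "\<dots> = ennreal (\<Sum>i\<le>d. f i)" using f0 by (rule sum_ennreal)
  also have "(\<Sum>i\<le>d. f i) = W / W" by (simp add: f_def W_def flip: sum_divide_distrib)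
  also have "W / W = 1" using W1 by simp
  finally have f1: "(\<integral>\<^sup>+i. ennreal (f i) \<partial>count_space UNIV) = 1" by simp
  show ?thesis
  proof (intro exI[of _ "embed_pmf f"] conjI allI impI)
    show "set_pmf (embed_pmf f) \<subseteq> {..d}"
      unfolding set_embed_pmf[OF f0 f1] by (auto simp: f_def)
    fix i assume i: "i \<le> d"
    have "?w i / Suc d \<le> ?w i / W"
      using W1 W2 r by (intro divide_left_mono) auto
    then show "?w i / Suc d \<le> pmf (embed_pmf f) i"
      using i by (simp add: pmf_embed_pmf[OF f0 f1] f_def)
    have "?w i / W \<le> ?w i / 1"
      using W1 r by (intro divide_left_mono) auto
    then show "pmf (embed_pmf f) i \<le> ?w i"
      using i by (simp add: pmf_embed_pmf[OF f0 f1] f_def)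
  qed
qed

definition branch_pmf :: "nat \<Rightarrow> nat pmf" where
  "branch_pmf d = (SOME p. set_pmf p \<subseteq> {..d} \<and>
    (\<forall>i\<le>d. ratio d ^ (d - i) / Suc d \<le> pmf p i \<and> pmf p i \<le> ratio d ^ (d - i)))"

lemma branch_pmf:
  "set_pmf (branch_pmf d) \<subseteq> {..d}"
  "i \<le> d \<Longrightarrow> ratio d ^ (d - i) / Suc d \<le> pmf (branch_pmf d) i"
  "i \<le> d \<Longrightarrow> pmf (branch_pmf d) i \<le> ratio d ^ (d - i)"
  using someI_ex[OF branch_pmf_exists[of d], folded branch_pmf_def] by auto

lemma ratio_power_bounds: "0 < ratio d ^ k" "ratio d ^ k \<le> 1"
  unfolding ratio_def by (simp, intro power_le_one) auto

locale gadgets =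
  fixes width :: "nat \<Rightarrow> nat"
begin

abbreviation dep :: "nat \<Rightarrow> nat \<Rightarrow> nat" where
  "dep \<equiv> depth width"

text \<open>After this delay a dip of depth \<open>dep n i\<close> lowers the mean payoff to no less
  than -1 / (n+1). The next depth \<open>dep n (Suc i)\<close> is this delay plus
  \<open>dep n 0\<close>, a bound on the starting time of the gadget, plus 5 for the remaining
  steps.\<close>

definition delay :: "nat \<Rightarrow> nat \<Rightarrow> nat" where
  "delay n i = Suc n * dep n i"

fun nexts :: "node \<Rightarrow> node set" where
  "nexts (Start n) = (\<lambda>i. Delay n i (delay n i)) ` {..width n}"
| "nexts (Delay n i (Suc p)) = {Delay n i p}"
| "nexts (Delay n i 0) = {Choice n}"
| "nexts (Choice n) = Dip n ` {..width n}"
| "nexts (Dip n j) =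
    (if j \<le> width n then {Dip n (Suc (width n)), Start (Suc n)} else {Start (Suc n)})"

fun law :: "node \<Rightarrow> node pmf" where
  "law (Start n) = map_pmf (\<lambda>i. Delay n i (delay n i)) (branch_pmf (width n))"
| "law (Delay n i (Suc p)) = return_pmf (Delay n i p)"
| "law (Delay n i 0) = return_pmf (Choice n)"
| "law (Choice n) = return_pmf (Choice n)"
| "law (Dip n j) =
    (if j \<le> width n
     then map_pmf (\<lambda>b. if b then Dip n (Suc (width n)) else Start (Suc n))
       (bernoulli_pmf (ratio (width n) ^ Suc j))
     else return_pmf (Start (Suc n)))"

fun pot :: "node \<Rightarrow> real" where
  "pot (Dip n j) = - real (dep n j)"
| "pot _ = 0"

fun gadget :: "node \<Rightarrow> nat" where
  "gadget (Start n) = n"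
| "gadget (Delay n i p) = n"
| "gadget (Choice n) = n"
| "gadget (Dip n j) = n"

text \<open>Real values place a countdown of unbounded length below the fixed value of
  \<open>Choice n\<close>: the phase of a delay rises to 1/2 as its counter falls to 0. All phases
  stay below 1, so the next \<open>Start\<close> ranks higher.\<close>

fun phase :: "node \<Rightarrow> real" where
  "phase (Start n) = 0"
| "phase (Delay n i p) = 1 / (real p + 2)"
| "phase (Choice n) = 6 / 10"
| "phase (Dip n j) = (if j \<le> width n then 7 / 10 else 8 / 10)"

definition rank :: "node \<Rightarrow> real" where
  "rank u = real (gadget u) + phase u"

text \<open>The reward is the increment of a potential, which makes the total reward implicit.\<close>

definition G :: "nat mdp" where
  "G = \<lparr>controlled_states = to_nat ` range Choice,
    random_states = to_nat ` (- range Choice),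
    transitions = {(to_nat u, to_nat v) | u v. v \<in> nexts u},
    trans_prob = (\<lambda>s. map_pmf to_nat (law (from_nat s))),
    reward = (\<lambda>(s, t). pot (from_nat t) - pot (from_nat s))\<rparr>"

lemma states_G: "states G = range (to_nat :: node \<Rightarrow> nat)"
  by (auto simp: states_def G_def)

lemma succs_G: "succs G (to_nat u) = to_nat ` nexts u"
  by (auto simp: succs_def G_def)

lemma transitions_G [simp]: "(to_nat u, to_nat v) \<in> transitions G \<longleftrightarrow> v \<in> nexts u"
  by (auto simp: G_def)

lemma controlled_G [simp]: "to_nat u \<in> controlled_states G \<longleftrightarrow> u \<in> range Choice"
  by (auto simp: G_def)

lemma trans_prob_G [simp]: "trans_prob G (to_nat u) = map_pmf to_nat (law u)"
  by (simp add: G_def)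

lemma reward_G: "reward G (s, t) = pot (from_nat t) - pot (from_nat s)"
  by (simp add: G_def)

lemma rank_less: "v \<in> nexts u \<Longrightarrow> rank u < rank v"
  by (cases u rule: nexts.cases) (auto simp: rank_def field_simps split: if_splits)

lemma set_law: "u \<notin> range Choice \<Longrightarrow> set_pmf (law u) \<subseteq> nexts u"
  using branch_pmf(1) by (cases u rule: nexts.cases) (fastforce split: if_splits)+

lemma nexts_nonempty: "nexts u \<noteq> {}"
  by (cases u rule: nexts.cases) auto

lemma finite_nexts: "finite (nexts u)"
  by (cases u rule: nexts.cases) auto

lemma is_mdp_G: "is_mdp G"
  unfolding is_mdp_def
proof (intro conjI ballI)
  show "controlled_states G \<inter> random_states G = {}" by (auto simp: G_def)
  show "transitions G \<subseteq> states G \<times> states G"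
    unfolding states_G by (auto simp: G_def)
  show "succs G s \<noteq> {}" if "s \<in> states G" for s
    using that by (auto simp: states_G succs_G nexts_nonempty)
  show "set_pmf (trans_prob G s) \<subseteq> succs G s" if s: "s \<in> random_states G" for s
  proof -
    obtain u where "s = to_nat u" "u \<notin> range Choice" using s by (auto simp: G_def)
    then show ?thesis using set_law[of u] by (auto simp: succs_G)
  qed
qed simp

lemma finitely_branching_G: "finitely_branching G"
  by (auto simp: finitely_branching_def states_G succs_G finite_nexts)

lemma acyclic_G: "acyclic (transitions G)"
proof -
  have "rank (from_nat x) < rank (from_nat y)" if "(x, y) \<in> (transitions G)\<^sup>+" for x y
    using that
  proof induction
    case (base y)
    then show ?case by (auto simp: G_def rank_less)
  next
    case (step y z)
    then have "rank (from_nat y) < rank (from_nat z)" by (auto simp: G_def rank_less)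
    then show ?case using step.IH by simp
  qed
  then show ?thesis by (fastforce simp: acyclic_def)
qed

lemma integer_rewards_G: "integer_rewards G"
proof -
  have "pot u \<in> \<int>" for u by (cases u) auto
  then show ?thesis by (auto simp: integer_rewards_def reward_G)
qed

lemma total_reward_implicit_G: "total_reward_implicit G s0"
proof -
  have "path_reward G \<rho> = pot (from_nat (last \<rho>)) - pot (from_nat (hd \<rho>))" if "\<rho> \<noteq> []" for \<rho>
    using that sum_lessThan_telescope[of "\<lambda>i. pot (from_nat (\<rho> ! i))" "length \<rho> - 1"]
    by (simp add: path_reward_def reward_G hd_conv_nth last_conv_nth)
  then show ?thesis by (auto simp: total_reward_implicit_def partial_runs_def)
qed

section \<open>Decoded runs and the times at which they pass the gadgets\<close>

definition walk :: "(nat \<Rightarrow> node) \<Rightarrow> bool" where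
  "walk \<nu> \<longleftrightarrow> \<nu> 0 = Start 0 \<and> (\<forall>t. \<nu> (Suc t) \<in> nexts (\<nu> t))"

lemma runs_G:
  assumes "\<omega> \<in> runs G" "\<omega> 0 = to_nat (Start 0)"
  obtains \<nu> where "walk \<nu>" "\<omega> = (\<lambda>t. to_nat (\<nu> t))"
proof -
  define \<nu> where "\<nu> t = (from_nat (\<omega> t) :: node)" for t
  have eq: "\<omega> t = to_nat (\<nu> t)" for t
    using assms(1) by (auto simp: runs_def states_G \<nu>_def image_iff) (metis from_nat_to_nat)
  have "\<nu> (Suc t) \<in> nexts (\<nu> t)" for t
    using assms(1) unfolding runs_def eq by simp
  then have "walk \<nu>" using assms(2) by (simp add: walk_def \<nu>_def)
  then show thesis using that eq by blast
qed

lemma walk_rank: "walk \<nu> \<Longrightarrow> s < t \<Longrightarrow> rank (\<nu> s) < rank (\<nu> t)"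
  by (rule lift_Suc_mono_less[of "\<lambda>t. rank (\<nu> t)"]) (auto simp: walk_def rank_less)

lemma walk_inj: "walk \<nu> \<Longrightarrow> \<nu> s = \<nu> t \<Longrightarrow> s = t"
  by (metis linorder_neqE_nat order_less_irrefl walk_rank)

lemma walk_delay:
  assumes "walk \<nu>" "\<nu> t = Start n"
  obtains i where "i \<le> width n" "\<And>p. p \<le> delay n i \<Longrightarrow> \<nu> (t + 1 + p) = Delay n i (delay n i - p)"
    "\<nu> (t + delay n i + 2) = Choice n"
proof -
  have nx: "\<nu> (Suc t) \<in> nexts (\<nu> t)" for t using assms(1) by (simp add: walk_def)
  obtain i where i: "i \<le> width n" "\<nu> (t + 1) = Delay n i (delay n i)"
    using nx[of t] assms(2) by auto
  have d: "\<nu> (t + 1 + p) = Delay n i (delay n i - p)" if "p \<le> delay n i" for p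
    using that
  proof (induction p)
    case (Suc p)
    then have "\<nu> (t + 1 + p) = Delay n i (Suc (delay n i - Suc p))"
      by (simp add: Suc_diff_Suc)
    then show ?case using nx[of "t + 1 + p"] by simp
  qed (use i in simp)
  have "\<nu> (Suc (t + 1 + delay n i)) = Choice n"
    using nx[of "t + 1 + delay n i"] d[of "delay n i"] by simp
  then show thesis using that[OF i(1) d] by (simp add: add.commute)
qed

lemma depth_mono: "i \<le> j \<Longrightarrow> dep n i \<le> dep n j"
proof (rule lift_Suc_mono_le[of "dep n"])
  fix i show "dep n i \<le> dep n (Suc i)" by (cases n) auto
qed

text \<open>The left-hand side bounds the time at which a run that takes branch \<open>i\<close>
  leaves gadget \<open>n\<close>, so a dip with j > i on that branch is at least as deep as the run
  is old.\<close>

lemma depth_gt: "i < j \<Longrightarrow> dep n 0 + delay n i + 5 \<le> dep n j"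
  using depth_mono[of "Suc i" j n] by (cases n) (auto simp: delay_def)

text \<open>The depth of the deepest dip also serves as time bound for the next gadget:
  \<open>dep (Suc n) 0\<close> is \<open>dep n (Suc (width n))\<close>, which by
  \<open>depth_gt\<close> exceeds \<open>dep n 0\<close> by the longest passage,
  \<open>delay n i\<close> + 5 steps. The lower bound n \<le> t turns late gadgets into late
  times.\<close>

lemma walk_Start:
  assumes "walk \<nu>"
  obtains t where "\<nu> t = Start n" "n \<le> t" "t \<le> dep n 0"
proof -
  have "\<exists>t. \<nu> t = Start n \<and> n \<le> t \<and> t \<le> dep n 0"
  proof (induction n)
    case 0
    then show ?case using assms by (auto simp: walk_def)
  next
    case (Suc n)
    then obtain t where t: "\<nu> t = Start n" "n \<le> t" "t \<le> dep n 0" by blast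
    have nx: "\<nu> s \<in> nexts (\<nu> r)" if "s = Suc r" for r s using assms that by (simp add: walk_def)
    obtain i where i: "i \<le> width n" "\<nu> (t + delay n i + 2) = Choice n"
      using walk_delay[OF assms t(1)] by metis
    obtain j where j: "j \<le> width n" "\<nu> (t + delay n i + 3) = Dip n j"
      using nx[of "t + delay n i + 3" "t + delay n i + 2"] i by auto
    have dep: "dep n 0 + delay n i + 5 \<le> dep (Suc n) 0"
      using depth_gt[of i "Suc (width n)" n] i by simp
    consider "\<nu> (t + delay n i + 4) = Start (Suc n)" | "\<nu> (t + delay n i + 4) = Dip n (Suc (width n))"
      using nx[of "t + delay n i + 4" "t + delay n i + 3"] j by auto
    then show ?case
    proof cases
      case 1
      then show ?thesis using t dep by (intro exI[of _ "t + delay n i + 4"]) auto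
    next
      case 2
      then have "\<nu> (t + delay n i + 5) = Start (Suc n)"
        using nx[of "t + delay n i + 5" "t + delay n i + 4"] by simp
      then show ?thesis using t dep by (intro exI[of _ "t + delay n i + 5"]) auto
    qed
  qed
  then show thesis using that by blast
qed

lemma walk_Start_time:
  assumes "walk \<nu>" "\<nu> t = Start n"
  shows "t \<le> dep n 0"
  using walk_Start[OF assms(1), of n] walk_inj[OF assms(1)] assms(2) by metis

text \<open>The rewards telescope and \<open>pot\<close> is 0 at \<open>Start 0\<close>.\<close>

lemma MP_iff:
  assumes "walk \<nu>"
  shows "(\<lambda>t. to_nat (\<nu> t)) \<in> MP_liminf_ge_0 G \<longleftrightarrow>
    0 \<le> liminf (\<lambda>t. ereal (1 / real t * pot (\<nu> t)))"
proof -
  have "(\<lambda>t. to_nat (\<nu> t)) \<in> runs G"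
    using assms by (simp add: runs_def states_G walk_def)
  moreover have "(\<Sum>j<t. reward G (to_nat (\<nu> j), to_nat (\<nu> (Suc j)))) = pot (\<nu> t)" for t
    using sum_lessThan_telescope[of "\<lambda>j. pot (\<nu> j)" t] assms by (simp add: reward_G walk_def)
  ultimately show ?thesis by (simp add: MP_liminf_ge_0_def)
qed

end

section \<open>Finite-memory strategies fail\<close>

lemma cyl_append:
  "\<omega> \<in> cyl (h @ g) \<longleftrightarrow> \<omega> \<in> cyl h \<and> map \<omega> [length h..<length h + length g] = g"
proof -
  have "map \<omega> [0..<length h + length g] = map \<omega> [0..<length h] @ map \<omega> [length h..<length h + length g]"
    using upt_add_eq_append[of 0 "length h" "length g"] by simp
  then show ?thesis by (simp add: cyl_def)
qed

lemma successively_run: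
  assumes "\<And>t. (\<omega> t, \<omega> (Suc t)) \<in> transitions M" "\<And>t. \<omega> t \<in> states M"
  shows "map \<omega> [0..<Suc t] \<in> partial_runs M"
  using assms unfolding partial_runs_def
  by (auto simp: successively_conv_nth simp del: upt_Suc)

text \<open>A strategy is constrained on partial runs only, so the legality of a step and that of
  the prefix before it are proved in one induction.\<close>

lemma AE_runs:
  fixes M :: "'s::countable mdp"
  assumes M: "is_mdp M" and s0: "s0 \<in> states M" and \<sigma>: "\<sigma> \<in> strategies M"
  shows "AE \<omega> in run_measure M s0 \<sigma>. \<omega> \<in> runs M"
  using AE_run_follows
proof eventually_elim
  case (elim \<omega>)
  have next_run: "(\<omega> t, \<omega> (Suc t)) \<in> transitions M" if "map \<omega> [0..<Suc t] \<in> partial_runs M" for t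
  proof -
    have "\<omega> t \<in> states M" using that by (simp add: partial_runs_def)
    moreover have "\<omega> (Suc t) \<in> set_pmf (next_state M \<sigma> (map \<omega> [0..<Suc t]))" using elim by blast
    ultimately have "\<omega> (Suc t) \<in> succs M (\<omega> t)"
      using that \<sigma> M unfolding next_state_def strategies_def is_mdp_def states_def
      by (auto split: if_splits simp: subset_iff)
    then show ?thesis by (simp add: succs_def)
  qed
  have "map \<omega> [0..<Suc t] \<in> partial_runs M" for t
  proof (induction t)
    case 0
    then show ?case using elim s0 by (simp add: partial_runs_def)
  next
    case (Suc t)
    have "(\<omega> t, \<omega> (Suc t)) \<in> transitions M" by (rule next_run[OF Suc])
    moreover from this have "\<omega> (Suc t) \<in> states M" using M by (auto simp: is_mdp_def)
    ultimately show ?case using Suc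
      by (simp add: partial_runs_def successively_append_iff)
  qed
  then show ?case
    using next_run by (simp add: runs_def partial_runs_def)
qed

context gadgets
begin

lemma partial_runs_snoc:
  assumes "\<rho> \<in> partial_runs G" "last \<rho> = to_nat u" "v \<in> nexts u"
  shows "\<rho> @ [to_nat v] \<in> partial_runs G"
proof -
  have "to_nat v \<in> states G" by (simp add: states_G)
  then show ?thesis
    using assms by (simp add: partial_runs_def successively_append_iff)
qed

lemma not_Choice [simp]:
  "Start n \<notin> range Choice" "Delay n i p \<notin> range Choice" "Dip n j \<notin> range Choice"
  by auto

lemma path_prob_random:
  assumes "\<rho> \<noteq> []" "last \<rho> = to_nat u" "u \<notin> range Choice"
  shows "path_prob G s0 \<sigma> (\<rho> @ [to_nat v]) = path_prob G s0 \<sigma> \<rho> * pmf (law u) v"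
proof -
  have "next_state G \<sigma> \<rho> = map_pmf to_nat (law u)"
    unfolding next_state_def assms(2) using assms(3) by simp
  then show ?thesis
    using assms(1) by (simp only: path_prob_snoc pmf_map_inj'[OF inj_to_nat] if_False)
qed

section \<open>Loss of a finite-memory strategy in one gadget\<close>

definition delay_path :: "nat \<Rightarrow> nat \<Rightarrow> nat \<Rightarrow> node list" where
  "delay_path n i q = map (\<lambda>p. Delay n i (delay n i - p)) [0..<Suc q]"

text \<open>Made to be appended to a history that ends in \<open>Start n\<close>: the passage that
  escapes the deepest dip, up to the next start.\<close>

definition gadget_path :: "nat \<Rightarrow> nat \<Rightarrow> nat \<Rightarrow> node list" where
  "gadget_path n i j = delay_path n i (delay n i) @ [Choice n, Dip n j, Start (Suc n)]"

lemma pmf_law_Start: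
  "pmf (law (Start n)) (Delay n i (delay n i)) = pmf (branch_pmf (width n)) i"
proof -
  have "inj (\<lambda>i. Delay n i (delay n i))" by (auto simp: inj_def)
  from pmf_map_inj'[OF this, of "branch_pmf (width n)" i] show ?thesis by simp
qed

lemma delay_path:
  assumes h: "h \<in> partial_runs G" "last h = to_nat (Start n)" and i: "i \<le> width n" and q: "q \<le> delay n i"
  shows "h @ map to_nat (delay_path n i q) \<in> partial_runs G \<and>
    last (h @ map to_nat (delay_path n i q)) = to_nat (Delay n i (delay n i - q)) \<and>
    path_prob G s0 \<sigma> (h @ map to_nat (delay_path n i q)) =
      path_prob G s0 \<sigma> h * pmf (branch_pmf (width n)) i"
  using q
proof (induction q)
  case 0
  have "h \<noteq> []" using h by (auto simp: partial_runs_def)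
  then show ?case
    using partial_runs_snoc[OF h, of "Delay n i (delay n i)"]
      path_prob_random[OF _ h(2) not_Choice(1), of s0 \<sigma> "Delay n i (delay n i)"] i
    by (simp add: delay_path_def pmf_law_Start del: law.simps)
next
  case (Suc q)
  let ?h = "h @ map to_nat (delay_path n i q)"
  have IH: "?h \<in> partial_runs G" "last ?h = to_nat (Delay n i (Suc (delay n i - Suc q)))"
    "path_prob G s0 \<sigma> ?h = path_prob G s0 \<sigma> h * pmf (branch_pmf (width n)) i"
    using Suc by (auto simp: Suc_diff_Suc)
  have eq: "h @ map to_nat (delay_path n i (Suc q)) = ?h @ [to_nat (Delay n i (delay n i - Suc q))]"
    by (simp add: delay_path_def)
  let ?v = "Delay n i (delay n i - Suc q)"
  have ne: "?h \<noteq> []" using IH(1) by (auto simp: partial_runs_def)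
  have "?h @ [to_nat ?v] \<in> partial_runs G"
    by (rule partial_runs_snoc[OF IH(1,2)]) simp
  moreover have "path_prob G s0 \<sigma> (?h @ [to_nat ?v]) = path_prob G s0 \<sigma> ?h"
    using path_prob_random[OF ne IH(2) not_Choice(2), of s0 \<sigma> ?v] by simp
  ultimately show ?case unfolding eq IH(3) by simp
qed

text \<open>The probability of choosing \<open>j\<close> stays inside \<open>path_prob\<close>,
  since it depends on the strategy; for finite memory \<open>FR_mixture\<close> evaluates
  it.\<close>

lemma gadget_path:
  assumes h: "h \<in> partial_runs G" "last h = to_nat (Start n)" and i: "i \<le> width n"
  defines "hi \<equiv> h @ map to_nat (delay_path n i (delay n i) @ [Choice n])"
  shows "hi \<in> partial_runs G" "hd hi = hd h" "last hi = to_nat (Choice n)"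
    "path_prob G s0 \<sigma> hi = path_prob G s0 \<sigma> h * pmf (branch_pmf (width n)) i"
    "j \<le> width n \<Longrightarrow> path_prob G s0 \<sigma> (h @ map to_nat (gadget_path n i j)) =
      (1 - ratio (width n) ^ Suc j) * path_prob G s0 \<sigma> (hi @ [to_nat (Dip n j)])"
    "j \<le> width n \<Longrightarrow> h @ map to_nat (gadget_path n i j) \<in> partial_runs G"
proof -
  let ?h = "h @ map to_nat (delay_path n i (delay n i))"
  have d: "?h \<in> partial_runs G" "last ?h = to_nat (Delay n i 0)"
    "path_prob G s0 \<sigma> ?h = path_prob G s0 \<sigma> h * pmf (branch_pmf (width n)) i"
    using delay_path[OF h i, of "delay n i"] by auto
  have ne: "h \<noteq> []" "?h \<noteq> []" using h by (auto simp: partial_runs_def)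
  have hi: "hi = ?h @ [to_nat (Choice n)]" by (simp add: hi_def)
  show hi_run: "hi \<in> partial_runs G"
    unfolding hi by (rule partial_runs_snoc[OF d(1,2)]) simp
  show "hd hi = hd h" "last hi = to_nat (Choice n)" using ne by (auto simp: hi)
  show "path_prob G s0 \<sigma> hi = path_prob G s0 \<sigma> h * pmf (branch_pmf (width n)) i"
    unfolding hi using path_prob_random[OF ne(2) d(2), of s0 \<sigma> "Choice n"] d(3) by simp
  have eq: "h @ map to_nat (gadget_path n i j) =
      (hi @ [to_nat (Dip n j)]) @ [to_nat (Start (Suc n))]"
    by (simp add: gadget_path_def hi)
  assume j: "j \<le> width n"
  have hj: "hi @ [to_nat (Dip n j)] \<in> partial_runs G"
    by (rule partial_runs_snoc[OF hi_run]) (use j hi in auto)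
  show "h @ map to_nat (gadget_path n i j) \<in> partial_runs G"
    unfolding eq by (rule partial_runs_snoc[OF hj]) (use j in auto)
  have "pmf (law (Dip n j)) (Start (Suc n)) = 1 - ratio (width n) ^ Suc j"
  proof -
    have "inj (\<lambda>b. if b then Dip n (Suc (width n)) else Start (Suc n))" by (auto simp: inj_def)
    from pmf_map_inj'[OF this, of "bernoulli_pmf (ratio (width n) ^ Suc j)" False]
    show ?thesis using j ratio_power_bounds[of "width n" "Suc j"] by simp
  qed
  then show "path_prob G s0 \<sigma> (h @ map to_nat (gadget_path n i j)) =
      (1 - ratio (width n) ^ Suc j) * path_prob G s0 \<sigma> (hi @ [to_nat (Dip n j)])"
    unfolding eq using path_prob_random[of "hi @ [to_nat (Dip n j)]" "Dip n j" s0 \<sigma> "Start (Suc n)"]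
    by (auto simp: mult.commute)
qed

text \<open>The constant \<open>b\<close> of \<open>pigeonhole_loss\<close>. It bounds each branch
  probability from below, and also its product with the risk of any j < i, because
  (\<open>width n\<close> - i) + (j + 1) is at most \<open>width n\<close>.\<close>

definition gap :: "nat \<Rightarrow> real" where
  "gap n = ratio (width n) ^ width n / Suc (width n)"

text \<open>\<open>K\<close> is the number of modes. It depends on the strategy alone, so the loss
  is uniform over all histories that lead to the gadget; this uniformity stands in for
  independence.\<close>

lemma FR_gadget_loss:
  assumes "\<sigma> \<in> FR_strategies G"
  obtains K :: nat where "0 < K"
    "\<And>h n. h \<in> partial_runs G \<Longrightarrow> hd h = s0 \<Longrightarrow> last h = to_nat (Start n) \<Longrightarrow> K \<le> width n \<Longrightarrow>
      (\<Sum>i\<le>width n. \<Sum>j\<le>i. path_prob G s0 \<sigma> (h @ map to_nat (gadget_path n i j))) \<le>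
      (1 - gap n / K) * path_prob G s0 \<sigma> h"
proof -
  obtain Q :: "nat set" and w c where Q: "finite Q" "Q \<noteq> {}" and w: "\<And>\<rho> m. 0 \<le> w \<rho> m"
    and c: "\<And>m s. m \<in> Q \<Longrightarrow> s \<in> controlled_states G \<Longrightarrow> set_pmf (c m s) \<subseteq> succs G s"
    and P: "\<And>\<rho>. \<rho> \<in> partial_runs G \<Longrightarrow> hd \<rho> = s0 \<Longrightarrow> path_prob G s0 \<sigma> \<rho> = (\<Sum>m\<in>Q. w \<rho> m)"
    and PD: "\<And>\<rho> t. \<rho> \<in> partial_runs G \<Longrightarrow> hd \<rho> = s0 \<Longrightarrow> last \<rho> \<in> controlled_states G \<Longrightarrow>
      path_prob G s0 \<sigma> (\<rho> @ [t]) = (\<Sum>m\<in>Q. w \<rho> m * pmf (c m (last \<rho>)) t)"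
    by (rule FR_mixture[OF is_mdp_G assms, of s0]) blast
  show thesis
  proof (rule that[of "card Q"])
    show "0 < card Q" using Q by (simp add: card_gt_0_iff)
    fix h n
    assume h: "h \<in> partial_runs G" "hd h = s0" "last h = to_nat (Start n)" and K: "card Q \<le> width n"
    define hi where "hi i = h @ map to_nat (delay_path n i (delay n i) @ [Choice n])" for i
    define \<mu> where "\<mu> i m = w (hi i) m" for i m
    define x where "x j m = pmf (c m (to_nat (Choice n))) (to_nat (Dip n j))" for j m
    let ?\<delta> = "\<lambda>i. pmf (branch_pmf (width n)) i"
    let ?\<epsilon> = "\<lambda>j. ratio (width n) ^ Suc j"
    note gp = gadget_path[OF h(1,3), folded hi_def]
    have "(\<Sum>i\<le>width n. \<Sum>j\<le>i. path_prob G s0 \<sigma> (h @ map to_nat (gadget_path n i j))) =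
        (\<Sum>i\<le>width n. \<Sum>j\<le>i. (1 - ?\<epsilon> j) * (\<Sum>m\<in>Q. \<mu> i m * x j m))"
    proof (intro sum.cong refl)
      fix i j assume "i \<in> {..width n}" "j \<in> {..i}"
      then show "path_prob G s0 \<sigma> (h @ map to_nat (gadget_path n i j)) =
          (1 - ?\<epsilon> j) * (\<Sum>m\<in>Q. \<mu> i m * x j m)"
        using gp(5)[of i j s0 \<sigma>] PD[of "hi i"] gp(1,2,3)[of i] h(2)
        by (simp add: \<mu>_def x_def)
    qed
    also have "\<dots> \<le> (1 - gap n / card Q) * path_prob G s0 \<sigma> h"
    proof (rule pigeonhole_loss[OF Q K])
      show "(\<Sum>m\<in>Q. \<mu> i m) = ?\<delta> i * path_prob G s0 \<sigma> h" if "i \<le> width n" for i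
        using P[of "hi i"] gp(1,2,4)[OF that] h(2) by (simp add: \<mu>_def mult.commute)
      show "(\<Sum>i\<le>width n. ?\<delta> i) = 1"
        using branch_pmf(1) by (intro sum_pmf_eq_1) auto
      show "(\<Sum>j\<le>width n. x j m) = 1" if "m \<in> Q" for m
      proof -
        let ?A = "(\<lambda>j. to_nat (Dip n j)) ` {..width n}"
        have "(\<Sum>j\<le>width n. x j m) = (\<Sum>s\<in>?A. pmf (c m (to_nat (Choice n))) s)"
          by (subst sum.reindex) (auto simp: inj_on_def x_def)
        also have "\<dots> = 1"
          using c[OF that, of "to_nat (Choice n)"] by (intro sum_pmf_eq_1) (auto simp: succs_G image_image)
        finally show ?thesis .
      qed
      show "0 \<le> ?\<epsilon> j" "?\<epsilon> j \<le> 1" for j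
        using ratio_power_bounds[of "width n" "Suc j"] by linarith+
      have r: "0 \<le> ratio (width n)" "ratio (width n) \<le> 1"
        using ratio_power_bounds[of "width n" 1] by simp_all
      show "gap n \<le> ?\<delta> i" if "i \<le> width n" for i
      proof -
        have "gap n \<le> ratio (width n) ^ (width n - i) / Suc (width n)"
          unfolding gap_def using r by (intro divide_right_mono power_decreasing) auto
        then show ?thesis using branch_pmf(2)[OF that] by linarith
      qed
      show "gap n \<le> ?\<delta> i * ?\<epsilon> j" if "j < i" "i \<le> width n" for i j
      proof -
        have "gap n \<le> ratio (width n) ^ (width n - i + Suc j) / Suc (width n)"
          unfolding gap_def using r that by (intro divide_right_mono power_decreasing) auto
        also have "\<dots> = ratio (width n) ^ (width n - i) / Suc (width n) * ?\<epsilon> j"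
          by (simp add: power_add)
        also have "\<dots> \<le> ?\<delta> i * ?\<epsilon> j"
          using branch_pmf(2)[OF that(2)] r by (intro mult_right_mono) auto
        finally show ?thesis .
      qed
    qed (auto simp: \<mu>_def x_def w)
    finally show "(\<Sum>i\<le>width n. \<Sum>j\<le>i. path_prob G s0 \<sigma> (h @ map to_nat (gadget_path n i j))) \<le>
        (1 - gap n / card Q) * path_prob G s0 \<sigma> h" .
  qed
qed

text \<open>The extensions of the history \<open>h0\<close> through \<open>q\<close> further gadgets with no dip that brings
  the mean payoff down to \<open>-1\<close>.\<close>

fun good_ext :: "nat list \<Rightarrow> nat \<Rightarrow> nat \<Rightarrow> nat list set" where
  "good_ext h0 n0 0 = {h0}"
| "good_ext h0 n0 (Suc q) = (\<lambda>(h, i, j). h @ map to_nat (gadget_path (n0 + q) i j)) `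
     (good_ext h0 n0 q \<times> (SIGMA i:{..width (n0 + q)}. {..i}))"

lemma finite_good_ext: "finite (good_ext h0 n0 q)"
  by (induction q) auto

lemma good_ext:
  assumes "h0 \<in> partial_runs G" "last h0 = to_nat (Start n0)" "h \<in> good_ext h0 n0 q"
  shows "h \<in> partial_runs G \<and> hd h = hd h0 \<and> last h = to_nat (Start (n0 + q))"
  using assms(3)
proof (induction q arbitrary: h)
  case 0
  then show ?case using assms by simp
next
  case (Suc q)
  then obtain h' i j where h': "h' \<in> good_ext h0 n0 q" "i \<le> width (n0 + q)" "j \<le> i"
    and h: "h = h' @ map to_nat (gadget_path (n0 + q) i j)" by auto
  note IH = Suc.IH[OF h'(1)]
  then show ?case
    using gadget_path(6)[of h' "n0 + q" i j] h'(2,3)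
    by (auto simp: h partial_runs_def) (simp add: gadget_path_def)
qed

text \<open>A relative loss of \<open>c n\<close> after every history multiplies the surviving mass
  by 1 - \<open>c n\<close>, which is at most exp (- \<open>c n\<close>).\<close>

lemma good_ext_mass:
  assumes h0: "h0 \<in> partial_runs G" "last h0 = to_nat (Start n0)"
    and loss: "\<And>h n. h \<in> partial_runs G \<Longrightarrow> hd h = hd h0 \<Longrightarrow> last h = to_nat (Start n) \<Longrightarrow> n0 \<le> n \<Longrightarrow>
      (\<Sum>i\<le>width n. \<Sum>j\<le>i. path_prob G s0 \<sigma> (h @ map to_nat (gadget_path n i j))) \<le>
      (1 - c n) * path_prob G s0 \<sigma> h"
  shows "(\<Sum>h\<in>good_ext h0 n0 q. path_prob G s0 \<sigma> h) \<le> exp (- (\<Sum>k<q. c (n0 + k)))"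
proof (induction q)
  case 0
  interpret prob_space "run_measure G s0 \<sigma>" by (rule prob_space_run_measure)
  show ?case by (simp add: path_prob_def)
next
  case (Suc q)
  let ?I = "SIGMA i:{..width (n0 + q)}. {..i}"
  let ?P = "path_prob G s0 \<sigma>"
  \<comment> \<open>Only an upper bound is wanted, so coinciding extensions do no harm.\<close>
  have "(\<Sum>h\<in>good_ext h0 n0 (Suc q). ?P h) \<le>
      (\<Sum>(h, i, j)\<in>good_ext h0 n0 q \<times> ?I. ?P (h @ map to_nat (gadget_path (n0 + q) i j)))"
    unfolding good_ext.simps
    by (rule order_trans[OF sum_image_le]) (auto simp: finite_good_ext case_prod_unfold o_def)
  also have "\<dots> = (\<Sum>h\<in>good_ext h0 n0 q. \<Sum>i\<le>width (n0 + q). \<Sum>j\<le>i.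
      ?P (h @ map to_nat (gadget_path (n0 + q) i j)))"
    by (simp add: sum.cartesian_product[symmetric] sum.Sigma[symmetric])
  also have "\<dots> \<le> (\<Sum>h\<in>good_ext h0 n0 q. (1 - c (n0 + q)) * ?P h)"
    using good_ext[OF h0] by (intro sum_mono loss) auto
  also have "\<dots> = (1 - c (n0 + q)) * (\<Sum>h\<in>good_ext h0 n0 q. ?P h)"
    by (simp add: sum_distrib_left)
  also have "\<dots> \<le> exp (- c (n0 + q)) * (\<Sum>h\<in>good_ext h0 n0 q. ?P h)"
    using exp_ge_add_one_self[of "- c (n0 + q)"] by (intro mult_right_mono sum_nonneg) auto
  also have "\<dots> \<le> exp (- c (n0 + q)) * exp (- (\<Sum>k<q. c (n0 + k)))"
    by (intro mult_left_mono Suc.IH) simp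
  also have "\<dots> = exp (- (\<Sum>k<Suc q. c (n0 + k)))"
    by (simp add: exp_add[symmetric])
  finally show ?case .
qed

lemma good_ext_null:
  assumes h0: "h0 \<in> partial_runs G" "last h0 = to_nat (Start n0)"
    and loss: "\<And>h n. h \<in> partial_runs G \<Longrightarrow> hd h = hd h0 \<Longrightarrow> last h = to_nat (Start n) \<Longrightarrow> n0 \<le> n \<Longrightarrow>
      (\<Sum>i\<le>width n. \<Sum>j\<le>i. path_prob G s0 \<sigma> (h @ map to_nat (gadget_path n i j))) \<le>
      (1 - c n) * path_prob G s0 \<sigma> h"
    and c: "\<And>n. 0 \<le> c n" "\<not> summable c"
  shows "AE \<omega> in run_measure G s0 \<sigma>. \<exists>q. \<forall>h\<in>good_ext h0 n0 q. \<omega> \<notin> cyl h"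
proof -
  interpret prob_space "run_measure G s0 \<sigma>" by (rule prob_space_run_measure)
  define E where "E q = (\<Union>h\<in>good_ext h0 n0 q. cyl h)" for q
  have E: "E q \<in> sets (run_measure G s0 \<sigma>)" for q
    unfolding E_def using finite_good_ext by (intro sets.finite_UN) auto
  have "prob (\<Inter>q. E q) \<le> exp (- (\<Sum>k<q. c (n0 + k)))" for q
  proof -
    have "prob (\<Inter>q. E q) \<le> prob (E q)"
      by (intro finite_measure_mono E) auto
    also have "\<dots> \<le> (\<Sum>h\<in>good_ext h0 n0 q. path_prob G s0 \<sigma> h)"
      unfolding E_def path_prob_def
      by (intro finite_measure_subadditive_finite finite_good_ext) auto
    also have "\<dots> \<le> exp (- (\<Sum>k<q. c (n0 + k)))"
      by (rule good_ext_mass[OF h0 loss])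
    finally show ?thesis .
  qed
  moreover have "\<exists>q. B < (\<Sum>k<q. c (n0 + k))" for B
  proof (rule ccontr)
    assume "\<not> ?thesis"
    then have "summable (\<lambda>k. c (n0 + k))"
      using c(1) by (intro summableI_nonneg_bounded[of _ B]) (auto simp: not_less)
    then show False using c(2) summable_iff_shift[of c n0] by (simp add: add.commute)
  qed
  ultimately have "\<not> 0 < prob (\<Inter>q. E q)"
  proof (intro notI)
    assume le: "\<And>q. prob (\<Inter>q. E q) \<le> exp (- (\<Sum>k<q. c (n0 + k)))"
      and ex: "\<And>B. \<exists>q. B < (\<Sum>k<q. c (n0 + k))" and pos: "0 < prob (\<Inter>q. E q)"
    obtain q where "- ln (prob (\<Inter>q. E q)) < (\<Sum>k<q. c (n0 + k))" using ex by blast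
    then have "exp (- (\<Sum>k<q. c (n0 + k))) < exp (ln (prob (\<Inter>q. E q)))" by simp
    then show False using le[of q] pos by simp
  qed
  then have "prob (\<Inter>q. E q) = 0" using measure_nonneg[of _ "\<Inter>q. E q"] by (simp add: order_less_le)
  then have "AE \<omega> in run_measure G s0 \<sigma>. \<omega> \<notin> (\<Inter>q. E q)"
    using E by (intro AE_not_in null_setsI) (auto simp: emeasure_eq_measure)
  then show ?thesis by (rule AE_mp) (auto simp: E_def)
qed

lemma walk_good_gadget:
  assumes \<nu>: "walk \<nu>" "\<nu> t = Start n" and good: "\<And>s. t \<le> s \<Longrightarrow> - real s < pot (\<nu> s)"
  shows "\<exists>i\<le>width n. \<exists>j\<le>i. map \<nu> [Suc t..<Suc t + length (gadget_path n i j)] = gadget_path n i j"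
proof -
  have nx: "\<nu> s \<in> nexts (\<nu> r)" if "s = Suc r" for r s using \<nu>(1) that by (simp add: walk_def)
  obtain i where i: "i \<le> width n" "\<nu> (t + delay n i + 2) = Choice n"
    and d: "\<And>p. p \<le> delay n i \<Longrightarrow> \<nu> (t + 1 + p) = Delay n i (delay n i - p)"
    using walk_delay[OF \<nu>] by metis
  \<comment> \<open>A dip with j > i is at least as deep as the elapsed time, by
    \<open>depth_gt\<close> and t \<le> \<open>dep n 0\<close>. This is applied to the chosen dip
    and to the deepest one.\<close>
  have shallow: "j \<le> i" if "\<nu> s = Dip n j" "t \<le> s" "s \<le> t + delay n i + 5" for s j
    using good[OF that(2)] that walk_Start_time[OF \<nu>] depth_gt[of i j n] by (force simp: not_le[symmetric])
  obtain j where j: "j \<le> width n" "\<nu> (t + delay n i + 3) = Dip n j"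
    using nx[of "t + delay n i + 3" "t + delay n i + 2"] i by auto
  have ji: "j \<le> i" using shallow[OF j(2)] by simp
  have "\<nu> (t + delay n i + 4) \<noteq> Dip n (Suc (width n))"
    using shallow[of "t + delay n i + 4" "Suc (width n)"] i(1) by auto
  then have s: "\<nu> (t + delay n i + 4) = Start (Suc n)"
    using nx[of "t + delay n i + 4" "t + delay n i + 3"] j by auto
  have "map \<nu> [Suc t..<Suc t + length (gadget_path n i j)] = gadget_path n i j"
  proof (rule nth_equalityI)
    fix k assume "k < length (map \<nu> [Suc t..<Suc t + length (gadget_path n i j)])"
    then have k: "k < Suc (delay n i) + 3"
      by (simp add: gadget_path_def delay_path_def del: upt_Suc)
    consider "k \<le> delay n i" | "k = delay n i + 1" | "k = delay n i + 2" | "k = delay n i + 3"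
      using k by linarith
    then show "map \<nu> [Suc t..<Suc t + length (gadget_path n i j)] ! k = gadget_path n i j ! k"
      using i j s d[of k] by cases (auto simp: gadget_path_def delay_path_def nth_append
        numeral_eq_Suc simp del: upt_Suc)
  qed (simp del: upt_Suc)
  then show ?thesis using i(1) ji by blast
qed

text \<open>The counterpart of \<open>good_ext_null\<close>: a run whose mean payoff stays above -1
  after \<open>Start n0\<close> never leaves the good extensions, which almost no run
  manages.\<close>

lemma good_ext_walk:
  assumes \<nu>: "walk \<nu>" "\<nu> t0 = Start n0" and good: "\<And>s. t0 \<le> s \<Longrightarrow> - real s < pot (\<nu> s)"
  defines "\<omega> \<equiv> \<lambda>t. to_nat (\<nu> t)"
  shows "\<exists>h\<in>good_ext (map \<omega> [0..<Suc t0]) n0 q. \<omega> \<in> cyl h \<and> Suc t0 \<le> length h \<and>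
    \<nu> (length h - 1) = Start (n0 + q)"
proof (induction q)
  case 0
  then show ?case using \<nu>(2) by (simp add: cyl_def del: upt_Suc)
next
  case (Suc q)
  then obtain h where h: "h \<in> good_ext (map \<omega> [0..<Suc t0]) n0 q" "\<omega> \<in> cyl h" "Suc t0 \<le> length h"
    "\<nu> (length h - 1) = Start (n0 + q)" by blast
  have gd: "- real s < pot (\<nu> s)" if "length h - 1 \<le> s" for s
    using h(3) that by (intro good) linarith
  obtain i j where ij: "i \<le> width (n0 + q)" "j \<le> i"
    "map \<nu> [Suc (length h - 1)..<Suc (length h - 1) + length (gadget_path (n0 + q) i j)] =
      gadget_path (n0 + q) i j"
    using walk_good_gadget[OF \<nu>(1) h(4) gd] by blast
  let ?g = "gadget_path (n0 + q) i j"
  have len: "Suc (length h - 1) = length h" using h(3) by simp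
  have m: "map \<nu> [length h..<length h + length ?g] = ?g" using ij(3) unfolding len .
  have "map \<omega> [length h..<length h + length ?g] = map to_nat ?g"
    by (subst m[symmetric]) (simp add: \<omega>_def)
  then have "\<omega> \<in> cyl (h @ map to_nat ?g)" using h(2) by (simp add: cyl_append)
  moreover have "\<nu> (length (h @ map to_nat ?g) - 1) = Start (n0 + Suc q)"
  proof -
    have "length ?g > 0" by (simp add: gadget_path_def)
    then have "?g ! (length ?g - 1) = \<nu> (length h + (length ?g - 1))"
      by (subst m[symmetric]) simp
    moreover have "?g ! (length ?g - 1) = Start (n0 + Suc q)"
      by (simp add: gadget_path_def nth_append)
    ultimately show ?thesis using \<open>length ?g > 0\<close> by simp
  qed
  moreover have "h @ map to_nat ?g \<in> good_ext (map \<omega> [0..<Suc t0]) n0 (Suc q)"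
    using h(1) ij(1,2) by (auto intro!: image_eqI[of _ _ "(h, i, j)"] simp del: upt_Suc)
  ultimately show ?case using h(3) by (intro bexI[of _ "h @ map to_nat ?g"]) auto
qed

abbreviation s0 :: nat where
  "s0 \<equiv> to_nat (Start 0)"

lemma FR_MP_null:
  assumes \<sigma>: "\<sigma> \<in> FR_strategies G" and gap: "\<not> summable gap"
    and width: "\<And>K. eventually (\<lambda>n. K \<le> width n) sequentially"
  shows "measure (run_measure G s0 \<sigma>) (MP_liminf_ge_0 G) = 0"
proof -
  obtain K :: nat where K: "0 < K" and loss:
    "\<And>h n. h \<in> partial_runs G \<Longrightarrow> hd h = s0 \<Longrightarrow> last h = to_nat (Start n) \<Longrightarrow> K \<le> width n \<Longrightarrow>
      (\<Sum>i\<le>width n. \<Sum>j\<le>i. path_prob G s0 \<sigma> (h @ map to_nat (gadget_path n i j))) \<le>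
      (1 - gap n / K) * path_prob G s0 \<sigma> h"
    by (rule FR_gadget_loss[OF \<sigma>, of s0]) blast
  obtain n1 where n1: "\<And>n. n1 \<le> n \<Longrightarrow> K \<le> width n"
    using width[of K] by (auto simp: eventually_sequentially)
  have gap0: "0 \<le> gap n / K" for n
    using ratio_power_bounds(1)[of "width n" "width n"] by (simp add: gap_def)
  have gapK: "\<not> summable (\<lambda>n. gap n / K)"
    using gap summable_mult[of "\<lambda>n. gap n / K" K] K by auto
  \<comment> \<open>The time from which the mean payoff stays above -1 depends on the run, so all of
    the countably many pairs of a history and a gadget are treated at once.\<close>
  have "AE \<omega> in run_measure G s0 \<sigma>. h0 \<in> partial_runs G \<and> hd h0 = s0 \<and>
      last h0 = to_nat (Start n0) \<and> n1 \<le> n0 \<longrightarrow> (\<exists>q. \<forall>h\<in>good_ext h0 n0 q. \<omega> \<notin> cyl h)" for h0 n0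
  proof (cases "h0 \<in> partial_runs G \<and> hd h0 = s0 \<and> last h0 = to_nat (Start n0) \<and> n1 \<le> n0")
    case True
    then have "AE \<omega> in run_measure G s0 \<sigma>. \<exists>q. \<forall>h\<in>good_ext h0 n0 q. \<omega> \<notin> cyl h"
      using n1 by (intro good_ext_null[OF _ _ _ gap0 gapK] loss) auto
    then show ?thesis by (rule AE_mp) simp
  next
    case False
    then show ?thesis by (intro AE_I2) blast
  qed
  then have "AE \<omega> in run_measure G s0 \<sigma>. \<forall>h0 n0. h0 \<in> partial_runs G \<and> hd h0 = s0 \<and>
      last h0 = to_nat (Start n0) \<and> n1 \<le> n0 \<longrightarrow> (\<exists>q. \<forall>h\<in>good_ext h0 n0 q. \<omega> \<notin> cyl h)"
    by (simp add: AE_all_countable)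
  then have "AE \<omega> in run_measure G s0 \<sigma>. \<omega> \<notin> MP_liminf_ge_0 G"
    using AE_run_follows
  proof eventually_elim
    case (elim \<omega>)
    show ?case
    proof
      assume MP: "\<omega> \<in> MP_liminf_ge_0 G"
      then have run: "\<omega> \<in> runs G" by (simp add: MP_liminf_ge_0_def)
      obtain \<nu> where \<nu>: "walk \<nu>" "\<omega> = (\<lambda>t. to_nat (\<nu> t))"
        using runs_G[OF run] elim by blast
      have "0 \<le> liminf (\<lambda>t. ereal (1 / real t * pot (\<nu> t)))"
        using MP \<nu> MP_iff by simp
      then have "eventually (\<lambda>t. - 1 < ereal (1 / real t * pot (\<nu> t))) sequentially"
        by (simp add: le_Liminf_iff)
      then obtain N where N: "\<And>t. N \<le> t \<Longrightarrow> - 1 < 1 / real t * pot (\<nu> t)"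
        by (auto simp: eventually_sequentially one_ereal_def)
      \<comment> \<open>Past \<open>n1\<close> the gadgets are wider than the memory, past
        \<open>N\<close> the mean payoff exceeds -1, and \<open>Suc\<close> keeps the times positive
        for the division.\<close>
      define n0 where "n0 = Suc (max n1 N)"
      obtain t0 where t0: "\<nu> t0 = Start n0" "n0 \<le> t0"
        using walk_Start[OF \<nu>(1), of n0] by blast
      have good: "- real s < pot (\<nu> s)" if "t0 \<le> s" for s
      proof -
        have "N \<le> s" "0 < s" using that t0 by (auto simp: n0_def)
        then show ?thesis using N[of s] by (simp add: field_simps)
      qed
      let ?h0 = "map \<omega> [0..<Suc t0]"
      have "?h0 \<in> partial_runs G"
        by (rule successively_run) (use run in \<open>auto simp: runs_def\<close>)
      moreover have "hd ?h0 = s0" using elim by (simp add: hd_map del: upt_Suc)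
      moreover have "last ?h0 = to_nat (Start n0)" using \<nu>(2) t0 by simp
      moreover have "n1 \<le> n0" by (simp add: n0_def)
      ultimately obtain q where "\<forall>h\<in>good_ext ?h0 n0 q. \<omega> \<notin> cyl h"
        using elim by blast
      then show False
        using good_ext_walk[OF \<nu>(1) t0(1) good, of q] unfolding \<nu>(2) by blast
    qed
  qed
  then have "MP_liminf_ge_0 G \<in> null_sets (run_measure G s0 \<sigma>)"
    by (subst AE_iff_null_sets) (simp_all add: sets_run_measure sets_MP_liminf_ge_0)
  then show ?thesis by (rule measure_eq_0_null_sets)
qed

end

section \<open>Remembering the branch succeeds\<close>

context gadgets
begin

text \<open>Partial runs may start anywhere, for instance at \<open>Choice n\<close> or at
  \<open>Delay n i 0\<close> with i > \<open>width n\<close>; the default \<open>Dip n 0\<close> and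
  the \<open>min\<close> make the choice legal there too.\<close>

fun recall :: "node \<Rightarrow> node \<Rightarrow> node" where
  "recall (Delay m i p) (Choice n) = Dip n (min i (width n))"
| "recall u (Choice n) = Dip n 0"
| "recall u v = v"

text \<open>The state before \<open>Choice n\<close> is \<open>Delay n i 0\<close>, which still
  shows the branch. Looking back one step is thus enough, but the number of branches to be told
  apart is unbounded.\<close>

definition recalling :: "nat strategy" where
  "recalling \<rho> = return_pmf (to_nat (recall (from_nat (last (butlast \<rho>))) (from_nat (last \<rho>))))"

lemma recall_Choice: "recall u (Choice n) \<in> nexts (Choice n)"
  by (cases u) auto

lemma recalling_strategy: "recalling \<in> strategies G"
proof -
  have "set_pmf (recalling \<rho>) \<subseteq> succs G (last \<rho>)" if c: "last \<rho> \<in> controlled_states G" for \<rho>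
  proof -
    obtain n where n: "last \<rho> = to_nat (Choice n)" using c by (auto simp: G_def)
    show ?thesis
      using recall_Choice unfolding n succs_G by (auto simp: recalling_def n simp del: nexts.simps)
  qed
  then show ?thesis by (simp add: strategies_def)
qed

definition remembers :: "(nat \<Rightarrow> node) \<Rightarrow> bool" where
  "remembers \<nu> \<longleftrightarrow> walk \<nu> \<and>
    (\<forall>t n i. i \<le> width n \<longrightarrow> \<nu> t = Delay n i 0 \<longrightarrow> \<nu> (Suc (Suc t)) = Dip n i)"

lemma AE_remembers:
  "AE \<omega> in run_measure G s0 recalling. \<exists>\<nu>. remembers \<nu> \<and> \<omega> = (\<lambda>t. to_nat (\<nu> t))"
proof -
  have "s0 \<in> states G" by (simp add: states_G)
  from AE_runs[OF is_mdp_G this recalling_strategy] AE_run_follows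
  show ?thesis
  proof eventually_elim
    case (elim \<omega>)
    obtain \<nu> where \<nu>: "walk \<nu>" "\<omega> = (\<lambda>t. to_nat (\<nu> t))"
      using runs_G elim by metis
    have "\<nu> (Suc (Suc t)) = Dip n i" if i: "i \<le> width n" and t: "\<nu> t = Delay n i 0" for t n i
    proof -
      have c: "\<nu> (Suc t) = Choice n" using \<nu>(1) t unfolding walk_def by (metis nexts.simps(3) singletonD)
      let ?\<rho> = "map \<omega> [0..<Suc (Suc t)]"
      have "last ?\<rho> = to_nat (Choice n)" "last (butlast ?\<rho>) = to_nat (Delay n i 0)"
        using c t by (simp_all add: \<nu>(2) butlast_append)
      then have "next_state G recalling ?\<rho> = return_pmf (to_nat (Dip n i))"
        using i by (simp add: next_state_def recalling_def min_absorb1 del: upt_Suc)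
      moreover have "\<omega> (Suc (Suc t)) \<in> set_pmf (next_state G recalling ?\<rho>)" using elim by blast
      ultimately show ?thesis by (simp add: \<nu>(2))
    qed
    then show ?case using \<nu> by (auto simp: remembers_def)
  qed
qed

lemma Dip_pred:
  assumes "Dip n j \<in> nexts u"
  shows "(u = Choice n \<and> j \<le> width n) \<or> (\<exists>i\<le>width n. u = Dip n i \<and> j = Suc (width n))"
  using assms by (cases u rule: nexts.cases) (auto split: if_splits)

text \<open>A walk meets each node at most once, so the \<open>Choice n\<close> before the dip is
  the one that follows the branching of gadget \<open>n\<close>, and the choice there reveals the
  branch.\<close>

lemma remembers_Dip:
  assumes \<nu>: "remembers \<nu>" and t: "\<nu> t = Dip n j" and j: "j \<le> width n"
  obtains t0 where "\<nu> t0 = Start n" "\<nu> (Suc t0) = Delay n j (delay n j)" "t = t0 + delay n j + 3"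
proof -
  have w: "walk \<nu>" using \<nu> by (simp add: remembers_def)
  obtain t0 where t0: "\<nu> t0 = Start n" using walk_Start[OF w] by metis
  obtain i where i: "i \<le> width n" "\<nu> (t0 + delay n i + 2) = Choice n"
    and d: "\<And>p. p \<le> delay n i \<Longrightarrow> \<nu> (t0 + 1 + p) = Delay n i (delay n i - p)"
    using walk_delay[OF w t0] by metis
  have "\<nu> (Suc (Suc (t0 + 1 + delay n i))) = Dip n i"
    using \<nu> i(1) d[of "delay n i"] by (simp add: remembers_def)
  then have Di: "\<nu> (t0 + delay n i + 3) = Dip n i" by (simp add: numeral_3_eq_3)
  obtain t' where t': "t = Suc t'" using w t by (cases t) (auto simp: walk_def)
  have "Dip n j \<in> nexts (\<nu> t')" using w t unfolding t' walk_def by metis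
  then have "\<nu> t' = Choice n" using Dip_pred[of n j "\<nu> t'"] j by auto
  then have "t' = t0 + delay n i + 2" using walk_inj[OF w] i(2) by metis
  then have "t = t0 + delay n i + 3" by (simp add: t')
  moreover from this have "i = j" using Di t by simp
  ultimately show thesis using that[OF t0] d[of 0] by simp
qed

abbreviation step_event :: "node \<Rightarrow> node \<Rightarrow> (nat \<Rightarrow> nat) set" where
  "step_event u v \<equiv> {\<omega>. \<exists>t. \<omega> t = to_nat u \<and> (\<forall>s<t. \<omega> s \<noteq> to_nat u) \<and> \<omega> (Suc t) = to_nat v}"

lemma sets_step_event [measurable]: "step_event u v \<in> sets (run_measure G s \<sigma>)"
proof -
  have "{\<omega> \<in> space (run_measure G s \<sigma>). \<exists>t. \<omega> t = to_nat u \<and> (\<forall>s<t. \<omega> s \<noteq> to_nat u) \<and>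
      \<omega> (Suc t) = to_nat v} \<in> sets (run_measure G s \<sigma>)"
    by measurable
  then show ?thesis by simp
qed

text \<open>Walks never return to a node, so every visit is a first visit.\<close>

lemma walk_step_event:
  assumes "walk \<nu>" "\<nu> t = u" "\<nu> (Suc t) = v"
  shows "(\<lambda>t. to_nat (\<nu> t)) \<in> step_event u v"
  using assms walk_inj[OF assms(1)] by (auto intro!: exI[of _ t])

lemma prob_step_event:
  assumes "u \<notin> range Choice"
  shows "measure (run_measure G s \<sigma>) (step_event u v) \<le>
    pmf (law u) v * measure (run_measure G s \<sigma>) {\<omega>. \<exists>t. \<omega> t = to_nat u}"
  using prob_first_visit_step[of "to_nat u" G s \<sigma> "to_nat v"] assms
  by (simp add: pmf_map_inj'[OF inj_to_nat])

text \<open>The deepest dip is entered from some \<open>Dip n i\<close>, which under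
  \<open>recalling\<close> is visited only after branch \<open>i\<close>. Branch bound r^(d-i) times
  risk r^(i+1) is r^(d+1) for each of the d+1 values of i, where d = \<open>width n\<close> and r =
  \<open>ratio d\<close>.\<close>

lemma prob_deepest_Dip:
  "measure (run_measure G s0 recalling) {\<omega>. \<exists>t. \<omega> t = to_nat (Dip n (Suc (width n)))} \<le>
    Suc (width n) * ratio (width n) ^ Suc (width n)"
proof -
  let ?R = "run_measure G s0 recalling"
  let ?V = "\<lambda>u. {\<omega>. \<exists>t. \<omega> t = (to_nat (u :: node) :: nat)}"
  let ?r = "ratio (width n)"
  interpret prob_space ?R by (rule prob_space_run_measure)
  have "prob (?V (Dip n (Suc (width n)))) \<le> prob (\<Union>i\<le>width n. step_event (Dip n i) (Dip n (Suc (width n))))"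
  proof (rule finite_measure_mono_AE)
    show "AE \<omega> in ?R. \<omega> \<in> ?V (Dip n (Suc (width n))) \<longrightarrow>
        \<omega> \<in> (\<Union>i\<le>width n. step_event (Dip n i) (Dip n (Suc (width n))))"
      using AE_remembers
    proof eventually_elim
      case (elim \<omega>)
      then obtain \<nu> where \<nu>: "walk \<nu>" "\<omega> = (\<lambda>t. to_nat (\<nu> t))" by (auto simp: remembers_def)
      show ?case
      proof
        assume "\<omega> \<in> ?V (Dip n (Suc (width n)))"
        then obtain t where t: "\<nu> t = Dip n (Suc (width n))" by (auto simp: \<nu>(2))
        obtain t' where t': "t = Suc t'" using \<nu>(1) t by (cases t) (auto simp: walk_def)
        have "Dip n (Suc (width n)) \<in> nexts (\<nu> t')" using \<nu>(1) t unfolding t' walk_def by metis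
        then obtain i where "i \<le> width n" "\<nu> t' = Dip n i" using Dip_pred by fastforce
        then show "\<omega> \<in> (\<Union>i\<le>width n. step_event (Dip n i) (Dip n (Suc (width n))))"
          using walk_step_event[OF \<nu>(1)] t unfolding \<nu>(2) t' by blast
      qed
    qed
  qed (intro sets.finite_UN sets_step_event finite_atMost)
  also have "\<dots> \<le> (\<Sum>i\<le>width n. prob (step_event (Dip n i) (Dip n (Suc (width n)))))"
    by (intro finite_measure_subadditive_finite) (auto intro: sets_step_event)
  also have "\<dots> \<le> (\<Sum>i\<le>width n. ?r ^ Suc i * ?r ^ (width n - i))"
  proof (rule sum_mono)
    fix i assume "i \<in> {..width n}"
    then have i: "i \<le> width n" by simp
    have "pmf (law (Dip n i)) (Dip n (Suc (width n))) = ?r ^ Suc i"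
    proof -
      have "inj (\<lambda>b. if b then Dip n (Suc (width n)) else Start (Suc n))" by (auto simp: inj_def)
      from pmf_map_inj'[OF this, of "bernoulli_pmf (?r ^ Suc i)" True]
      show ?thesis using i ratio_power_bounds[of "width n" "Suc i"] by simp
    qed
    then have "prob (step_event (Dip n i) (Dip n (Suc (width n)))) \<le> ?r ^ Suc i * prob (?V (Dip n i))"
      using prob_step_event[OF not_Choice(3), of s0 recalling n i "Dip n (Suc (width n))"] by simp
    also have "\<dots> \<le> ?r ^ Suc i * ?r ^ (width n - i)"
    proof (intro mult_left_mono)
      have "prob (?V (Dip n i)) \<le> prob (step_event (Start n) (Delay n i (delay n i)))"
      proof (rule finite_measure_mono_AE)
        show "AE \<omega> in ?R. \<omega> \<in> ?V (Dip n i) \<longrightarrow>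
            \<omega> \<in> step_event (Start n) (Delay n i (delay n i))"
          using AE_remembers
        proof eventually_elim
          case (elim \<omega>)
          then obtain \<nu> where \<nu>: "remembers \<nu>" "\<omega> = (\<lambda>t. to_nat (\<nu> t))" by blast
          show ?case
          proof
            assume "\<omega> \<in> ?V (Dip n i)"
            then obtain t where t: "\<nu> t = Dip n i" by (auto simp: \<nu>(2))
            obtain t0 where "\<nu> t0 = Start n" "\<nu> (Suc t0) = Delay n i (delay n i)"
              by (rule remembers_Dip[OF \<nu>(1) t i])
            then show "\<omega> \<in> step_event (Start n) (Delay n i (delay n i))"
              using walk_step_event \<nu>(1) unfolding \<nu>(2) remembers_def by blast
          qed
        qed
      qed (rule sets_step_event)
      also have "\<dots> \<le> pmf (branch_pmf (width n)) i * prob (?V (Start n))"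
        using prob_step_event[OF not_Choice(1), of s0 recalling n "Delay n i (delay n i)"]
        by (simp only: pmf_law_Start)
      also have "\<dots> \<le> ?r ^ (width n - i) * 1"
        using branch_pmf(3)[OF i] ratio_power_bounds[of "width n"]
        by (intro mult_mono) (auto simp: less_imp_le)
      finally show "prob (?V (Dip n i)) \<le> ?r ^ (width n - i)" by simp
    qed (use ratio_power_bounds[of "width n" "Suc i"] in linarith)
    finally show "prob (step_event (Dip n i) (Dip n (Suc (width n)))) \<le> ?r ^ Suc i * ?r ^ (width n - i)" .
  qed
  also have "\<dots> = (\<Sum>i\<le>width n. ?r ^ Suc (width n))"
    by (intro sum.cong refl) (simp add: power_add[symmetric])
  also have "\<dots> = Suc (width n) * ?r ^ Suc (width n)" by simp
  finally show ?thesis .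
qed

lemma depth_Start_mono: "m \<le> n \<Longrightarrow> dep m 0 \<le> dep n 0"
  by (rule lift_Suc_mono_le[of "\<lambda>n. dep n 0"]) (use depth_mono in auto)

text \<open>The rank serves as a clock: \<open>Dip n j\<close> ranks below
  \<open>Start (Suc n)\<close>, whose time is bounded.\<close>

lemma walk_Dip_time:
  assumes "walk \<nu>" "\<nu> t = Dip n j"
  shows "t \<le> dep (Suc n) 0"
proof -
  obtain t' where t': "\<nu> t' = Start (Suc n)" "t' \<le> dep (Suc n) 0"
    using walk_Start[OF assms(1), of "Suc n"] by metis
  have "rank (\<nu> t) < rank (\<nu> t')"
    unfolding assms(2) t'(1) by (simp add: rank_def)
  then have "\<not> t' < t" using walk_rank[OF assms(1), of t' t] by linarith
  then show ?thesis using t'(2) by linarith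
qed

text \<open>Outside dips the total reward is 0. A dip that is not deepest has j = i and comes after
  the delay \<open>Suc n * dep n i\<close>, so the mean payoff there is at least -1 / (n+1).\<close>

lemma remembers_liminf:
  assumes \<nu>: "remembers \<nu>" and N1: "\<And>n t. N1 \<le> n \<Longrightarrow> \<nu> t \<noteq> Dip n (Suc (width n))"
  shows "0 \<le> liminf (\<lambda>t. ereal (1 / real t * pot (\<nu> t)))"
  unfolding le_Liminf_iff
proof (intro allI impI)
  have w: "walk \<nu>" using \<nu> by (simp add: remembers_def)
  fix y :: ereal assume "y < 0"
  then obtain r where r: "y \<le> ereal r" "r < 0"
    by (cases y) (auto intro: that[of "-1"])
  obtain N where N: "inverse (real (Suc N)) < - r"
    using reals_Archimedean[of "- r"] r by auto
  define n2 where "n2 = max N N1"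
  \<comment> \<open>By such a time \<open>t\<close> all dips of the gadgets up to \<open>n2\<close>
    are over.\<close>
  have "- inverse (real (Suc n2)) \<le> 1 / real t * pot (\<nu> t)" if t: "dep (Suc n2) 0 < t" for t
  proof (cases "\<nu> t")
    case (Dip n j)
    have "\<not> n \<le> n2"
      using walk_Dip_time[OF w Dip] depth_Start_mono[of "Suc n" "Suc n2"] t by fastforce
    then have n: "n2 \<le> n" "N1 \<le> n" by (auto simp: n2_def)
    obtain t' where t': "t = Suc t'" using t by (cases t) auto
    have "Dip n j \<in> nexts (\<nu> t')" using w Dip unfolding t' walk_def by metis
    then have "j \<le> width n" using Dip_pred N1[OF n(2), of t] Dip by metis
    then obtain t0 where "t = t0 + delay n j + 3"
      using remembers_Dip[OF \<nu> Dip] by metis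
    then have "Suc n * dep n j \<le> t" by (simp add: delay_def)
    moreover have "Suc n2 * dep n j \<le> Suc n * dep n j" using n(1) by (intro mult_right_mono) auto
    ultimately have "Suc n2 * dep n j \<le> t" by linarith
    then have "real (Suc n2) * real (dep n j) \<le> real t" by (simp flip: of_nat_mult del: of_nat_Suc)
    then show ?thesis using t Dip by (simp add: field_simps del: of_nat_Suc)
  qed auto
  moreover have "y < ereal (- inverse (real (Suc n2)))"
  proof -
    have "inverse (real (Suc n2)) \<le> inverse (real (Suc N))" by (simp add: n2_def le_imp_inverse_le)
    then have "r < - inverse (real (Suc n2))" using N by linarith
    then show ?thesis using r(1) by (meson ereal_less_eq(3) less_ereal.simps(1) order_le_less_trans)
  qed
  ultimately have "y < ereal (1 / real t * pot (\<nu> t))" if "dep (Suc n2) 0 < t" for t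
    using that by (meson ereal_less_eq(3) order_less_le_trans)
  then show "eventually (\<lambda>t. y < ereal (1 / real t * pot (\<nu> t))) sequentially"
    using eventually_gt_at_top[of "dep (Suc n2) 0"] by (rule eventually_mono[rotated])
qed

lemma recalling_MP:
  assumes "summable (\<lambda>n. Suc (width n) * ratio (width n) ^ Suc (width n))"
  shows "measure (run_measure G s0 recalling) (MP_liminf_ge_0 G) = 1"
proof -
  let ?R = "run_measure G s0 recalling"
  let ?B = "\<lambda>n. {\<omega>. \<exists>t. \<omega> t = to_nat (Dip n (Suc (width n)))}"
  interpret prob_space ?R by (rule prob_space_run_measure)
  have "summable (\<lambda>n. prob (?B n))"
    by (rule summable_comparison_test'[OF assms, of 0]) (use prob_deepest_Dip in simp)
  then have "AE \<omega> in ?R. eventually (\<lambda>n. \<omega> \<in> space ?R - ?B n) sequentially"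
    by (intro borel_cantelli_AE1) (auto simp: emeasure_eq_measure)
  then have "AE \<omega> in ?R. \<omega> \<in> MP_liminf_ge_0 G"
    using AE_remembers
  proof eventually_elim
    case (elim \<omega>)
    then obtain \<nu> where \<nu>: "remembers \<nu>" "\<omega> = (\<lambda>t. to_nat (\<nu> t))" by blast
    from elim(1) obtain N1 where "\<And>n t. N1 \<le> n \<Longrightarrow> \<nu> t \<noteq> Dip n (Suc (width n))"
      by (auto simp: eventually_sequentially \<nu>(2))
    from remembers_liminf[OF \<nu>(1) this] show ?case
      using \<nu> MP_iff by (simp add: remembers_def)
  qed
  then show ?thesis
    by (subst prob_eq_1) (simp_all add: sets_run_measure sets_MP_liminf_ge_0)
qed

end

theorem theorem4p15:
  shows "\<exists>(M :: nat mdp) s0.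
    is_mdp M \<and> s0 \<in> states M \<and>
    finitely_branching M \<and> acyclic (transitions M) \<and>
    integer_rewards M \<and> total_reward_implicit M s0 \<and>
    mdp_value M s0 (MP_liminf_ge_0 M) = 1 \<and>
    (\<forall>\<sigma>\<in>FR_strategies M. measure (run_measure M s0 \<sigma>) (MP_liminf_ge_0 M) = 0)"
proof -
  obtain width :: "nat \<Rightarrow> nat" where width: "\<And>K. eventually (\<lambda>n. K \<le> width n) sequentially"
    "summable (\<lambda>n. Suc (width n) * ratio (width n) ^ Suc (width n))"
    "\<not> summable (\<lambda>n. ratio (width n) ^ width n / Suc (width n))"
    by (rule gadget_sizes) blast
  interpret gadgets width .
  have "mdp_value G s0 (MP_liminf_ge_0 G) = 1"
    unfolding mdp_value_def
  \<comment> \<open>The supremum is attained, by \<open>recalling\<close>.\<close>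
  proof (rule cSup_eq_maximum)
    show "1 \<in> (\<lambda>\<sigma>. measure (run_measure G s0 \<sigma>) (MP_liminf_ge_0 G)) ` strategies G"
      using recalling_MP[OF width(2)] recalling_strategy by (intro image_eqI[of _ _ recalling]) auto
    show "x \<le> 1" if "x \<in> (\<lambda>\<sigma>. measure (run_measure G s0 \<sigma>) (MP_liminf_ge_0 G)) ` strategies G" for x
      using that prob_space.prob_le_1[OF prob_space_run_measure] by auto
  qed
  moreover have "\<not> summable gap" using width(3) by (simp add: gap_def[abs_def])
  ultimately show ?thesis
    using is_mdp_G finitely_branching_G acyclic_G integer_rewards_G total_reward_implicit_G
      FR_MP_null[OF _ _ width(1)]
    by (intro exI[of _ G] exI[of _ s0]) (auto simp: states_G)
qed

end
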